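(* Let $k\ge 3$. There are infinitely many positive integers $n$ divisible by $k$ for which there exists a tournament on $n$ players with $H=C_k$ that cannot be extended and has (1) $\left\lfloor\frac{n+2}{4}-\frac{n}{4k}\right\rfloor$ rounds, if $k$ is odd; (2) $\left\lfloor\frac{n+2}{4}\right\rfloor$ rounds, if $k\equiv 0\pmod 4$; (3) $\left\lfloor\frac{n+2}{4}\right\rfloor+1$ rounds, if $k\equiv 2\pmod 4$.
   Context: $C_k$ denotes the cycle on $k$ vertices. A $C_k$-factor of a graph on $n$ vertices is a set of $n/k$ vertex-disjoint cycles of length $k$ covering all vertices. A tournament with $r$ rounds on $n$ players with $H=C_k$ is a tuple $(H_1,\dots,H_r)$ of $C_k$-factors of the complete graph $K_n$ such that each edge of $K_n$ lies in at most one $H_i$. Its feasibility graph is $G=K_n\setminus\bigcup_{i\le r}H_i$; the tournament can be extended if $G$ contains a $C_k$-factor. *)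

theory Defs
  imports Complex_Main
begin

text \<open>A graph is given by a vertex set and a set of edges, each edge being a two-element set of
  vertices. A cycle is identified with its edge set (it has no isolated vertices), so that its
  vertex set is the union of its edges.\<close>

definition complete_edges :: "'a set \<Rightarrow> 'a set set" where
  "complete_edges V = {e. e \<subseteq> V \<and> card e = 2}"

definition cycle_edges :: "'a list \<Rightarrow> 'a set set" where
  "cycle_edges xs = {{xs ! i, xs ! (Suc i mod length xs)} | i. i < length xs}"

definition is_cycle :: "nat \<Rightarrow> 'a set set \<Rightarrow> bool" where
  "is_cycle k C \<longleftrightarrow> k \<ge> 3 \<and> (\<exists>xs. length xs = k \<and> distinct xs \<and> C = cycle_edges xs)"

definition cycle_factor :: "nat \<Rightarrow> 'a set \<Rightarrow> 'a set set \<Rightarrow> 'a set set set \<Rightarrow> bool" where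
  "cycle_factor k V E F \<longleftrightarrow>
     finite F \<and> k * card F = card V \<and>
     (\<forall>C\<in>F. is_cycle k C \<and> C \<subseteq> E) \<and>
     (\<forall>C\<in>F. \<forall>D\<in>F. C \<noteq> D \<longrightarrow> \<Union>C \<inter> \<Union>D = {}) \<and>
     (\<Union>C\<in>F. \<Union>C) = V"

text \<open>The players are \<open>0, \<dots>, n - 1\<close>. A tournament is the list of its rounds; the edge set of the
  factor \<open>F\<close> is \<open>\<Union>F\<close>.\<close>

definition tournament :: "nat \<Rightarrow> nat \<Rightarrow> nat set set set list \<Rightarrow> bool" where
  "tournament k n Hs \<longleftrightarrow>
     (\<forall>H\<in>set Hs. cycle_factor k {..<n} (complete_edges {..<n}) H) \<and>
     (\<forall>e\<in>complete_edges {..<n}. \<forall>i<length Hs. \<forall>j<length Hs.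
        e \<in> \<Union>(Hs ! i) \<and> e \<in> \<Union>(Hs ! j) \<longrightarrow> i = j)"

definition feasibility_edges :: "nat \<Rightarrow> nat set set set list \<Rightarrow> nat set set" where
  "feasibility_edges n Hs = complete_edges {..<n} - (\<Union>H\<in>set Hs. \<Union>H)"

definition can_be_extended :: "nat \<Rightarrow> nat \<Rightarrow> nat set set set list \<Rightarrow> bool" where
  "can_be_extended k n Hs \<longleftrightarrow> (\<exists>F. cycle_factor k {..<n} (feasibility_edges n Hs) F)"

end

theory Submission
  imports Defs "HOL-Library.Disjoint_Sets" "HOL-Library.Infinite_Set"
begin

text \<open>If \<open>k = 2 h + 1\<close>, let \<open>k ^ (i + 1) = 1 + 2 h N\<close> and \<open>n = 2 k N\<close>, and let the
  rounds use up all edges inside a set \<open>A\<close> of \<open>k ^ (i + 1)\<close> players. Then \<open>A\<close> is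
  independent in the feasibility graph, but a \<open>C\<^sub>k\<close>-factor has only \<open>2 N\<close> cycles, each meeting
  \<open>A\<close> in at most \<open>h\<close> players.

  If \<open>k = 2 l\<close>, the players are split into two halves of size \<open>m\<close>, an odd multiple of \<open>l\<close>, and the
  rounds use up the edges between the halves. For even \<open>l\<close> nothing is left between them, so every
  remaining cycle lies in a half, but \<open>k\<close> does not divide \<open>m\<close>. For odd \<open>l\<close> the complete bipartite
  graph minus a perfect matching is decomposed, and two more rounds use all of the matching but one
  edge; a bridge lies on no cycle, so the same argument applies.

  The decompositions are blow-ups of Hamiltonian decompositions of the complete graph and the
  complete bipartite graph, iterated inside the parts.\<close>

text \<open>A blow-up needs an odd factor \<open>g\<close>: the colours of adjacent vertices differ
  by 1 or 2, and both must be units modulo \<open>g\<close>. So parts are enlarged by odd factors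
  only, which also keeps the size of a half an odd multiple of \<open>l\<close>, not divisible by
  \<open>2 l\<close>. In the odd case the count misses by exactly one: \<open>2 N\<close> cycles
  hold at most \<open>2 h N\<close> players of \<open>A\<close>, which has \<open>2 h N + 1\<close>.
  For odd \<open>l\<close> a single round cannot use up the matching. The matching edges on a cycle
  are disjoint, and their number is even because they are its crossings between the halves; so a
  cycle of length \<open>2 l\<close> carries at most \<open>l - 1\<close> of them, and a round on
  \<open>m = l P\<close> pairs, which has \<open>P\<close> cycles, at most \<open>P (l - 1)\<close>.
  The first extra round attains this and leaves \<open>P\<close> matching edges; the second takes
  \<open>P - 1 = c (l - 1)\<close> of these with \<open>c\<close> cycles of the same shape. Both
  rounds also spend edges inside the halves and must not share any: there the first joins only
  vertices congruent modulo \<open>P\<close>, the second only incongruent ones.\<close>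

section \<open>Cycles and cycle factors\<close>

text \<open>Cycles as maps on positions instead of lists, so that relabelling vertices is
  composition.\<close>

definition cyc :: "nat \<Rightarrow> (nat \<Rightarrow> 'a) \<Rightarrow> 'a set set" where
  "cyc k f = (\<lambda>t. {f t, f (Suc t mod k)}) ` {..<k}"

lemma is_cycle_iff:
  "is_cycle k C \<longleftrightarrow> k \<ge> 3 \<and> (\<exists>f. inj_on f {..<k} \<and> C = cyc k f)"
proof -
  have "\<exists>f. inj_on f {..<k} \<and> C = cyc k f"
    if "length xs = k" "distinct xs" "C = cycle_edges xs" for xs
  proof (intro exI conjI)
    show "inj_on ((!) xs) {..<k}"
      using that by (auto intro!: inj_on_nth)
    show "C = cyc k ((!) xs)"
      using that by (auto simp: cyc_def cycle_edges_def)
  qed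
  moreover have "\<exists>xs. length xs = k \<and> distinct xs \<and> C = cycle_edges xs"
    if "inj_on f {..<k}" "C = cyc k f" "k \<ge> 3" for f
  proof (intro exI conjI)
    show "distinct (map f [0..<k])"
      using that by (simp add: distinct_map atLeast0LessThan)
    have "{map f [0..<k] ! i, map f [0..<k] ! (Suc i mod k)} = {f i, f (Suc i mod k)}"
      if "i < k" for i
    proof -
      have "Suc i mod k < k"
        using that by (intro mod_less_divisor) simp
      then show ?thesis
        using that by simp
    qed
    then have "cyc k f = (\<lambda>i. {map f [0..<k] ! i, map f [0..<k] ! (Suc i mod k)}) ` {..<k}"
      unfolding cyc_def by (intro image_cong) auto
    also have "\<dots> = cycle_edges (map f [0..<k])"
      unfolding cycle_edges_def length_map length_upt diff_zero by blast
    finally show "C = cycle_edges (map f [0..<k])"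
      using that by simp
  qed simp
  ultimately show ?thesis
    by (auto simp: is_cycle_def)
qed

lemma is_cycleI: "k \<ge> 3 \<Longrightarrow> inj_on f {..<k} \<Longrightarrow> is_cycle k (cyc k f)"
  by (auto simp: is_cycle_iff)

lemma Union_cyc [simp]: "\<Union>(cyc k f) = f ` {..<k}"
proof -
  have "f (Suc t mod k) \<in> f ` {..<k}" if "t < k" for t
    using that by (intro imageI) (auto intro: mod_less_divisor)
  then show ?thesis
    by (auto simp: cyc_def)
qed

text \<open>Two positions with the same edge would be cyclic successors of each other, which needs
  length at most 2.\<close>

lemma cyc_edge_inj:
  assumes "k \<ge> 3" "inj_on f {..<k}"
  shows "inj_on (\<lambda>t. {f t, f (Suc t mod k)}) {..<k}"
proof (rule inj_onI)
  fix i j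
  assume ij: "i \<in> {..<k}" "j \<in> {..<k}"
    and eq: "{f i, f (Suc i mod k)} = {f j, f (Suc j mod k)}"
  have lt: "Suc i mod k \<in> {..<k}" "Suc j mod k \<in> {..<k}"
    using assms(1) by auto
  show "i = j"
  proof (rule ccontr)
    assume "i \<noteq> j"
    then have "f i = f (Suc j mod k)" "f (Suc i mod k) = f j"
      using eq ij assms(2) by (auto simp: doubleton_eq_iff inj_on_eq_iff)
    then have eqs: "i = Suc j mod k" "j = Suc i mod k"
      using ij lt assms(2) by (metis inj_onD)+
    have suc: "Suc x = k \<and> Suc x mod k = 0 \<or> Suc x mod k = Suc x" if "x < k" for x
      using that by (cases "Suc x = k") auto
    have "Suc j = k \<and> i = 0 \<or> i = Suc j" "Suc i = k \<and> j = 0 \<or> j = Suc i"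
      unfolding eqs(1)[symmetric] eqs(2)[symmetric]
      using suc[of j] suc[of i] ij by (simp_all only: eqs[symmetric] lessThan_iff)
    then show False
      using assms(1) by (elim disjE conjE) linarith+
  qed
qed

lemma card_cyc: "k \<ge> 3 \<Longrightarrow> inj_on f {..<k} \<Longrightarrow> card (cyc k f) = k"
  unfolding cyc_def by (subst card_image) (auto intro: cyc_edge_inj)

lemma card_edge_cyc:
  assumes "k \<ge> 3" "inj_on f {..<k}" "e \<in> cyc k f"
  shows "card e = 2"
proof -
  obtain t where t: "t < k" "e = {f t, f (Suc t mod k)}"
    using assms(3) by (auto simp: cyc_def)
  have "Suc t mod k < k" "Suc t mod k \<noteq> t"
    using t assms(1) by (auto simp: mod_Suc)
  then have "f t \<noteq> f (Suc t mod k)"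
    using t assms(2) by (metis inj_onD lessThan_iff)
  then show ?thesis
    using t by simp
qed

lemma is_cycle_facts:
  assumes "is_cycle k C"
  shows "k \<ge> 3" "finite C" "card C = k" "finite (\<Union>C)" "card (\<Union>C) = k"
    and "\<And>e. e \<in> C \<Longrightarrow> card e = 2"
proof -
  obtain f where f: "k \<ge> 3" "inj_on f {..<k}" "C = cyc k f"
    using assms by (auto simp: is_cycle_iff)
  show "k \<ge> 3" by (rule f)
  show "card C = k" using f card_cyc by blast
  show "finite C" using f by (simp add: cyc_def)
  show "finite (\<Union>C)" using f by simp
  show "card (\<Union>C) = k" using f by (simp add: card_image)
  show "card e = 2" if "e \<in> C" for e using f card_edge_cyc that by blast
qed

lemma image_cyc: "(`) \<phi> ` cyc k f = cyc k (\<phi> \<circ> f)"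
  by (auto simp: cyc_def image_image)

lemma is_cycle_image:
  assumes "is_cycle k C" "inj_on \<phi> (\<Union>C)"
  shows "is_cycle k ((`) \<phi> ` C)"
proof -
  obtain f where f: "k \<ge> 3" "inj_on f {..<k}" "C = cyc k f"
    using assms by (auto simp: is_cycle_iff)
  then have "inj_on (\<phi> \<circ> f) {..<k}"
    using assms(2) by (intro comp_inj_on) auto
  then show ?thesis
    using f by (simp add: image_cyc is_cycleI)
qed

text \<open>The cardinality condition comes for free: the cycles have \<open>k\<close> vertices each
  and partition \<open>V\<close>.\<close>

lemma cycle_factorI:
  assumes "finite F" "\<And>C. C \<in> F \<Longrightarrow> is_cycle k C" "\<Union>(\<Union>F) = V" "\<Union>F \<subseteq> E"
    and "\<And>C D. C \<in> F \<Longrightarrow> D \<in> F \<Longrightarrow> C \<noteq> D \<Longrightarrow> \<Union>C \<inter> \<Union>D = {}"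
  shows "cycle_factor k V E F"
proof -
  have "V = (\<Union>C\<in>F. \<Union>C)"
    using assms(3) by auto
  then have "card V = (\<Sum>C\<in>F. card (\<Union>C))"
    using assms(1,5) is_cycle_facts(4)[OF assms(2)] by (simp only:, intro card_UN_disjoint) auto
  also have "\<dots> = (\<Sum>C\<in>F. k)"
    using assms by (intro sum.cong refl is_cycle_facts(5)) auto
  finally have "k * card F = card V"
    by simp
  then show ?thesis
    using assms unfolding cycle_factor_def by blast
qed

lemma cycle_factorD:
  assumes "cycle_factor k V E F"
  shows "finite F" "k * card F = card V" "\<And>C. C \<in> F \<Longrightarrow> is_cycle k C" "\<Union>F \<subseteq> E"
    and "\<And>C D. C \<in> F \<Longrightarrow> D \<in> F \<Longrightarrow> C \<noteq> D \<Longrightarrow> \<Union>C \<inter> \<Union>D = {}" "\<Union>(\<Union>F) = V"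
  using assms unfolding cycle_factor_def by auto

lemma cycle_factor_mono: "cycle_factor k V E F \<Longrightarrow> \<Union>F \<subseteq> E' \<Longrightarrow> cycle_factor k V E' F"
  unfolding cycle_factor_def by auto

lemma cycle_factor_edges:
  assumes "cycle_factor k V E F"
  shows "\<Union>F \<subseteq> complete_edges V"
proof
  fix e assume "e \<in> \<Union>F"
  then obtain C where C: "C \<in> F" "e \<in> C" by auto
  then have "card e = 2"
    using cycle_factorD(3)[OF assms] is_cycle_facts(6) by blast
  moreover have "e \<subseteq> V"
    using C cycle_factorD(6)[OF assms] by auto
  ultimately show "e \<in> complete_edges V"
    by (simp add: complete_edges_def)
qed

lemma cycle_factor_card_edges:
  assumes "cycle_factor k V E F"
  shows "card (\<Union>F) = card V" "finite (\<Union>F)"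
proof -
  note F = cycle_factorD[OF assms]
  have "C \<inter> D = {}" if CD: "C \<in> F" "D \<in> F" "C \<noteq> D" for C D
  proof (rule ccontr)
    assume "C \<inter> D \<noteq> {}"
    then obtain e where e: "e \<in> C" "e \<in> D" by blast
    then have "card e = 2"
      using F(3) CD is_cycle_facts(6) by blast
    then have "e \<noteq> {}" by auto
    then show False
      using F(5)[OF CD] e by blast
  qed
  then have "card (\<Union>F) = (\<Sum>C\<in>F. card C)"
    using is_cycle_facts(2)[OF F(3)] by (intro card_Union_disjoint) (auto simp: pairwise_def disjnt_def)
  also have "\<dots> = (\<Sum>C\<in>F. k)"
    using F by (intro sum.cong refl is_cycle_facts(3)) auto
  finally show "card (\<Union>F) = card V"
    using F(2) by (simp add: mult.commute)
  show "finite (\<Union>F)"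
    using F(1) is_cycle_facts(2)[OF F(3)] by blast
qed

lemma cycle_factor_Un:
  assumes "cycle_factor k V E F" "cycle_factor k V' E' F'" "V \<inter> V' = {}"
  shows "cycle_factor k (V \<union> V') (E \<union> E') (F \<union> F')"
proof (rule cycle_factorI)
  note F = cycle_factorD[OF assms(1)] and F' = cycle_factorD[OF assms(2)]
  show "finite (F \<union> F')" using F F' by simp
  show "is_cycle k C" if "C \<in> F \<union> F'" for C using that F F' by auto
  show "\<Union>(\<Union>(F \<union> F')) = V \<union> V'" using F(6) F'(6) by auto
  show "\<Union>(F \<union> F') \<subseteq> E \<union> E'" using F(4) F'(4) by auto
  show "\<Union>C \<inter> \<Union>D = {}" if CD: "C \<in> F \<union> F'" "D \<in> F \<union> F'" "C \<noteq> D" for C D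
  proof -
    have "C \<in> F \<Longrightarrow> \<Union>C \<subseteq> V" "D \<in> F \<Longrightarrow> \<Union>D \<subseteq> V" "C \<in> F' \<Longrightarrow> \<Union>C \<subseteq> V'" "D \<in> F' \<Longrightarrow> \<Union>D \<subseteq> V'"
      using F(6) F'(6) by blast+
    then show ?thesis
      using CD F(5) F'(5) assms(3) by (metis Un_iff disjoint_iff subset_eq)
  qed
qed

text \<open>Disjoint copies of one factor. They serve as the layers of a blow-up, for the recursion
  inside parts and, with a single copy, for relabelling.\<close>

lemma cycle_factor_images:
  assumes F: "cycle_factor k V E F" and "finite I"
    and inj: "\<And>x. x \<in> I \<Longrightarrow> inj_on (\<phi> x) V"
    and disj: "\<And>x y. x \<in> I \<Longrightarrow> y \<in> I \<Longrightarrow> x \<noteq> y \<Longrightarrow> \<phi> x ` V \<inter> \<phi> y ` V = {}"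
  shows "cycle_factor k (\<Union>x\<in>I. \<phi> x ` V) (\<Union>x\<in>I. (`) (\<phi> x) ` \<Union>F) (\<Union>x\<in>I. (\<lambda>C. (`) (\<phi> x) ` C) ` F)"
proof (rule cycle_factorI)
  note FD = cycle_factorD[OF F]
  have sub: "\<Union>C \<subseteq> V" if "C \<in> F" for C using FD(6) that by auto
  show "finite (\<Union>x\<in>I. (\<lambda>C. (`) (\<phi> x) ` C) ` F)"
    using FD(1) assms(2) by auto
  show "is_cycle k C" if C: "C \<in> (\<Union>x\<in>I. (\<lambda>C. (`) (\<phi> x) ` C) ` F)" for C
  proof -
    obtain x C' where C': "x \<in> I" "C' \<in> F" "C = (`) (\<phi> x) ` C'"
      using C by auto
    then show ?thesis
      using FD(3) is_cycle_image inj_on_subset[OF inj sub] by metis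
  qed
  show "\<Union>(\<Union>(\<Union>x\<in>I. (\<lambda>C. (`) (\<phi> x) ` C) ` F)) = (\<Union>x\<in>I. \<phi> x ` V)"
    unfolding FD(6)[symmetric] by auto
  show "\<Union>(\<Union>x\<in>I. (\<lambda>C. (`) (\<phi> x) ` C) ` F) \<subseteq> (\<Union>x\<in>I. (`) (\<phi> x) ` \<Union>F)"
    by auto
  show "\<Union>C \<inter> \<Union>D = {}"
    if CD: "C \<in> (\<Union>x\<in>I. (\<lambda>C. (`) (\<phi> x) ` C) ` F)" "D \<in> (\<Union>x\<in>I. (\<lambda>C. (`) (\<phi> x) ` C) ` F)" "C \<noteq> D"
    for C D
  proof -
    obtain x C' y D' where *: "x \<in> I" "C' \<in> F" "C = (`) (\<phi> x) ` C'"
      "y \<in> I" "D' \<in> F" "D = (`) (\<phi> y) ` D'"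
      using CD by blast
    have U: "\<Union>C = \<phi> x ` \<Union>C'" "\<Union>D = \<phi> y ` \<Union>D'"
      using * by auto
    show ?thesis
    proof (cases "x = y")
      case True
      then have "C' \<noteq> D'" using * CD by auto
      then have "\<Union>C' \<inter> \<Union>D' = {}" using FD(5) * by blast
      then show ?thesis
        using inj_on_image_Int[OF inj[OF *(1)] sub[OF *(2)] sub[OF *(5)]] True
        unfolding U by simp
    next
      case False
      then show ?thesis
        using Int_mono[OF image_mono[OF sub[OF *(2)]] image_mono[OF sub[OF *(5)]], of "\<phi> x" "\<phi> y"]
          disj[OF *(1,4)]
        unfolding U by simp
    qed
  qed
qed

section \<open>Decompositions into cycle factors\<close>

text \<open>\<open>D\<close> is exactly the set of edges spent, so batches of rounds are compatible
  when their \<open>D\<close> are disjoint, and the feasible edges are the complement.\<close>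

definition decomposes :: "nat \<Rightarrow> 'a set \<Rightarrow> 'a set set \<Rightarrow> nat \<Rightarrow> bool" where
  "decomposes k V D r \<longleftrightarrow>
     (\<exists>H. (\<forall>i<r. cycle_factor k V D (H i)) \<and> disjoint_family_on (\<lambda>i. \<Union>(H i)) {..<r} \<and>
          D = (\<Union>i<r. \<Union>(H i)))"

text \<open>An arbitrary finite index set lets rounds be indexed by sums and products before they
  are numbered.\<close>

lemma decomposesI:
  assumes "finite J" "card J = r" "\<And>j. j \<in> J \<Longrightarrow> cycle_factor k V (E j) (H j)"
    and "disjoint_family_on (\<lambda>j. \<Union>(H j)) J"
  shows "decomposes k V (\<Union>j\<in>J. \<Union>(H j)) r"
proof -
  obtain h where h: "bij_betw h {..<r} J"
    using ex_bij_betw_nat_finite[OF assms(1)] assms(2) by (auto simp: atLeast0LessThan)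
  then have hJ: "h i \<in> J" if "i < r" for i
    using that by (auto simp: bij_betw_def)
  have "(\<Union>j\<in>J. \<Union>(H j)) = (\<Union>i<r. \<Union>((H \<circ> h) i))"
    using h by (auto simp: bij_betw_def)
  moreover have "cycle_factor k V (\<Union>j\<in>J. \<Union>(H j)) ((H \<circ> h) i)" if "i < r" for i
    using assms(3)[OF hJ[OF that]] hJ[OF that] by (auto elim!: cycle_factor_mono)
  moreover have "disjoint_family_on (\<lambda>i. \<Union>((H \<circ> h) i)) {..<r}"
    using assms(4) h hJ unfolding disjoint_family_on_def bij_betw_def
    by (metis comp_apply inj_on_eq_iff lessThan_iff)
  ultimately show ?thesis
    unfolding decomposes_def by (intro exI[of _ "H \<circ> h"]) auto
qed

lemma decomposesE:
  assumes "decomposes k V D r"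
  obtains H where "\<And>i. i < r \<Longrightarrow> cycle_factor k V D (H i)"
    "disjoint_family_on (\<lambda>i. \<Union>(H i)) {..<r}" "D = (\<Union>i<r. \<Union>(H i))"
  using assms by (auto simp: decomposes_def)

lemma decomposes_0: "decomposes k V {} 0"
  by (simp add: decomposes_def disjoint_family_on_def)

lemma decomposes_1:
  assumes "cycle_factor k V E F"
  shows "decomposes k V (\<Union>F) 1"
  using decomposesI[of "{()}" 1 k V "\<lambda>_. E" "\<lambda>_. F"] assms
  by (simp add: disjoint_family_on_def)

lemma decomposes_edges: "decomposes k V D r \<Longrightarrow> D \<subseteq> complete_edges V"
  using cycle_factor_edges unfolding decomposes_def by blast

lemma decomposes_card:
  assumes "decomposes k V D r"
  shows "card D = r * card V" "finite D"
proof -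
  obtain H where H: "\<And>i. i < r \<Longrightarrow> cycle_factor k V D (H i)"
      "disjoint_family_on (\<lambda>i. \<Union>(H i)) {..<r}" "D = (\<Union>i<r. \<Union>(H i))"
    using assms by (rule decomposesE) blast
  have c: "card (\<Union>(H i)) = card V" "finite (\<Union>(H i))" if "i < r" for i
    using cycle_factor_card_edges[OF H(1)[OF that]] by auto
  have "card D = (\<Sum>i<r. card (\<Union>(H i)))"
    unfolding H(3) using c H(2) by (intro card_UN_disjoint) (auto simp: disjoint_family_on_def)
  also have "\<dots> = (\<Sum>i<r. card V)"
    using c by (intro sum.cong) auto
  finally show "card D = r * card V" by simp
  show "finite D" unfolding H(3) using c by blast
qed

text \<open>Every round spends \<open>card V\<close> edges, so an edge count turns an inclusion into
  an equality: a construction only has to show where its edges lie.\<close>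

lemma decomposes_eq:
  assumes "decomposes k V D r" "D \<subseteq> E" "finite E" "card E = r * card V"
  shows "D = E"
  using assms decomposes_card(1)[OF assms(1)] by (simp add: card_subset_eq)

lemma decomposes_add:
  assumes "decomposes k V D r" "decomposes k V D' r'" "D \<inter> D' = {}"
  shows "decomposes k V (D \<union> D') (r + r')"
proof -
  obtain H where H: "\<And>i. i < r \<Longrightarrow> cycle_factor k V D (H i)"
      "disjoint_family_on (\<lambda>i. \<Union>(H i)) {..<r}" "D = (\<Union>i<r. \<Union>(H i))"
    using assms(1) by (rule decomposesE) blast
  obtain H' where H': "\<And>i. i < r' \<Longrightarrow> cycle_factor k V D' (H' i)"
      "disjoint_family_on (\<lambda>i. \<Union>(H' i)) {..<r'}" "D' = (\<Union>i<r'. \<Union>(H' i))"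
    using assms(2) by (rule decomposesE) blast
  let ?J = "{..<r} <+> {..<r'}"
  have "decomposes k V (\<Union>j\<in>?J. \<Union>(case_sum H H' j)) (r + r')"
  proof (rule decomposesI)
    show "card ?J = r + r'" by (simp add: card_Plus)
    show "cycle_factor k V (case_sum (\<lambda>_. D) (\<lambda>_. D') j) (case_sum H H' j)" if "j \<in> ?J" for j
      using that H(1) H'(1) by auto
    show "disjoint_family_on (\<lambda>j. \<Union>(case_sum H H' j)) ?J"
      unfolding disjoint_family_on_def
    proof (intro ballI impI)
      fix i j assume ij: "i \<in> ?J" "j \<in> ?J" "i \<noteq> j"
      have sub: "\<Union>(H i) \<subseteq> D" if "i < r" for i using H(3) that by auto
      have sub': "\<Union>(H' i) \<subseteq> D'" if "i < r'" for i using H'(3) that by auto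
      from ij show "\<Union>(case_sum H H' i) \<inter> \<Union>(case_sum H H' j) = {}"
        using H(2) H'(2) sub sub' assms(3) unfolding disjoint_family_on_def
        by (elim PlusE) (simp_all, blast+)
    qed
  qed simp
  moreover have "(\<Union>j\<in>?J. \<Union>(case_sum H H' j)) = D \<union> D'"
    unfolding H(3) H'(3) by (auto simp: Plus_def)
  ultimately show ?thesis by simp
qed

lemma decomposes_fewer:
  assumes "decomposes k V D r" "r' \<le> r"
  obtains D' where "D' \<subseteq> D" "decomposes k V D' r'"
proof -
  obtain H where H: "\<And>i. i < r \<Longrightarrow> cycle_factor k V D (H i)"
      "disjoint_family_on (\<lambda>i. \<Union>(H i)) {..<r}" "D = (\<Union>i<r. \<Union>(H i))"
    using assms(1) by (rule decomposesE) blast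
  have "decomposes k V (\<Union>i\<in>{..<r'}. \<Union>(H i)) r'"
    using H assms(2) by (intro decomposesI[where E = "\<lambda>_. D"])
      (auto intro: disjoint_family_on_mono[where B = "{..<r}"])
  moreover have "(\<Union>i\<in>{..<r'}. \<Union>(H i)) \<subseteq> D"
    unfolding H(3) using assms(2) by force
  ultimately show ?thesis using that by blast
qed

text \<open>Rounds played in parallel on disjoint vertex sets; unlike in
  \<open>decomposes_add\<close>, the numbers of rounds must agree and do not add up.\<close>

lemma decomposes_Un:
  assumes "decomposes k V D r" "decomposes k V' D' r" "V \<inter> V' = {}"
  shows "decomposes k (V \<union> V') (D \<union> D') r"
proof -
  obtain H where H: "\<And>i. i < r \<Longrightarrow> cycle_factor k V D (H i)"
      "disjoint_family_on (\<lambda>i. \<Union>(H i)) {..<r}" "D = (\<Union>i<r. \<Union>(H i))"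
    using assms(1) by (rule decomposesE) blast
  obtain H' where H': "\<And>i. i < r \<Longrightarrow> cycle_factor k V' D' (H' i)"
      "disjoint_family_on (\<lambda>i. \<Union>(H' i)) {..<r}" "D' = (\<Union>i<r. \<Union>(H' i))"
    using assms(2) by (rule decomposesE) blast
  have "e \<noteq> {}" if "e \<in> complete_edges W" for e and W :: "'a set"
    using that by (auto simp: complete_edges_def)
  then have DD: "D \<inter> D' = {}"
    using decomposes_edges[OF assms(1)] decomposes_edges[OF assms(2)] assms(3)
    unfolding complete_edges_def by blast
  have "decomposes k (V \<union> V') (\<Union>i\<in>{..<r}. \<Union>(H i \<union> H' i)) r"
  proof (rule decomposesI)
    show "cycle_factor k (V \<union> V') (D \<union> D') (H i \<union> H' i)" if "i \<in> {..<r}" for i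
      using that H(1) H'(1) assms(3) by (intro cycle_factor_Un) auto
    show "disjoint_family_on (\<lambda>i. \<Union>(H i \<union> H' i)) {..<r}"
      unfolding disjoint_family_on_def
    proof (intro ballI impI)
      fix i j assume ij: "i \<in> {..<r}" "j \<in> {..<r}" "i \<noteq> j"
      have "\<Union>(H i) \<subseteq> D" "\<Union>(H j) \<subseteq> D" "\<Union>(H' i) \<subseteq> D'" "\<Union>(H' j) \<subseteq> D'"
        using H(3) H'(3) ij by auto
      moreover have "\<Union>(H i) \<inter> \<Union>(H j) = {}" "\<Union>(H' i) \<inter> \<Union>(H' j) = {}"
        using H(2) H'(2) ij by (auto simp: disjoint_family_on_def)
      ultimately show "\<Union>(H i \<union> H' i) \<inter> \<Union>(H j \<union> H' j) = {}"
        using DD by (simp add: Union_Un_distrib) blast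
    qed
  qed simp_all
  moreover have "(\<Union>i\<in>{..<r}. \<Union>(H i \<union> H' i)) = D \<union> D'"
    unfolding H(3) H'(3) by auto
  ultimately show ?thesis by simp
qed

lemma decomposes_images:
  assumes D: "decomposes k V D r" and "finite I"
    and inj: "\<And>x. x \<in> I \<Longrightarrow> inj_on (\<phi> x) V"
    and disj: "\<And>x y. x \<in> I \<Longrightarrow> y \<in> I \<Longrightarrow> x \<noteq> y \<Longrightarrow> \<phi> x ` V \<inter> \<phi> y ` V = {}"
  shows "decomposes k (\<Union>x\<in>I. \<phi> x ` V) (\<Union>x\<in>I. (`) (\<phi> x) ` D) r"
proof -
  obtain H where H: "\<And>i. i < r \<Longrightarrow> cycle_factor k V D (H i)"
      "disjoint_family_on (\<lambda>i. \<Union>(H i)) {..<r}" "D = (\<Union>i<r. \<Union>(H i))"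
    using D by (rule decomposesE) blast
  have HV: "e \<subseteq> V" "e \<noteq> {}" if "e \<in> \<Union>(H i)" "i < r" for e i
    using cycle_factor_edges[OF H(1)[OF that(2)]] that(1) by (auto simp: complete_edges_def)
  let ?H = "\<lambda>i. \<Union>x\<in>I. (\<lambda>C. (`) (\<phi> x) ` C) ` H i"
  have UH: "\<Union>(?H i) = (\<Union>x\<in>I. (`) (\<phi> x) ` \<Union>(H i))" for i
    by auto
  have "decomposes k (\<Union>x\<in>I. \<phi> x ` V) (\<Union>i\<in>{..<r}. \<Union>(?H i)) r"
  proof (rule decomposesI)
    show "cycle_factor k (\<Union>x\<in>I. \<phi> x ` V) (\<Union>x\<in>I. (`) (\<phi> x) ` \<Union>(H i)) (?H i)"
      if "i \<in> {..<r}" for i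
      using that H(1) assms by (intro cycle_factor_images) auto
    show "disjoint_family_on (\<lambda>i. \<Union>(?H i)) {..<r}"
      unfolding disjoint_family_on_def
    proof (intro ballI impI equals0I)
      fix i j e assume ij: "i \<in> {..<r}" "j \<in> {..<r}" "i \<noteq> j"
        and "e \<in> \<Union>(?H i) \<inter> \<Union>(?H j)"
      then have "e \<in> (\<Union>x\<in>I. (`) (\<phi> x) ` \<Union>(H i))" "e \<in> (\<Union>x\<in>I. (`) (\<phi> x) ` \<Union>(H j))"
        unfolding UH by simp_all
      then obtain x y a b where *: "x \<in> I" "y \<in> I" "a \<in> \<Union>(H i)" "b \<in> \<Union>(H j)"
        "e = \<phi> x ` a" "e = \<phi> y ` b"
        by (elim UN_E imageE) blast
      have ab: "a \<subseteq> V" "b \<subseteq> V" "a \<noteq> {}" using HV * ij by auto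
      have "x = y"
        using disj[OF *(1,2)] * ab by blast
      then have "a = b"
        using * ab inj_on_image_eq_iff[OF inj[OF \<open>x \<in> I\<close>]] by auto
      then show False
        using H(2) ij * by (auto simp: disjoint_family_on_def)
    qed
  qed simp_all
  moreover have "(\<Union>i\<in>{..<r}. \<Union>(?H i)) = (\<Union>x\<in>I. (`) (\<phi> x) ` D)"
    unfolding H(3) UH image_UN by blast
  ultimately show ?thesis by simp
qed

lemma decomposes_image:
  assumes "decomposes k V D r" "inj_on \<phi> V"
  shows "decomposes k (\<phi> ` V) ((`) \<phi> ` D) r"
  using decomposes_images[OF assms(1), of "{()}" "\<lambda>_. \<phi>"] assms(2) by simp

section \<open>Blowing up a decomposition\<close>

text \<open>Colours 0 and 1 alternate, and the last vertex gets 2 because the length may be odd.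
  Numerical colours below 3 keep all differences along edges in absolute value 1 or 2.\<close>

lemma cycle_colouring:
  assumes "is_cycle k C"
  shows "\<exists>s :: 'a \<Rightarrow> nat. (\<forall>v. s v < 3) \<and> (\<forall>e\<in>C. inj_on s e)"
proof -
  obtain f where f: "k \<ge> 3" "inj_on f {..<k}" "C = cyc k f"
    using assms by (auto simp: is_cycle_iff)
  define col :: "nat \<Rightarrow> nat" where "col t = (if Suc t = k then 2 else t mod 2)" for t
  define s where "s v = col (inv_into {..<k} f v)" for v
  have sf: "s (f t) = col t" if "t < k" for t
    using f(2) that by (simp add: s_def)
  have "col t \<noteq> col (Suc t mod k)" if "t < k" for t
  proof (cases "Suc t = k")
    case True
    then show ?thesis using f(1) by (simp add: col_def)
  next
    case False
    then have "Suc t mod k = Suc t" using that by simp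
    moreover have "t mod 2 \<noteq> Suc t mod 2" by presburger
    moreover have "t mod 2 \<noteq> 2" by simp
    ultimately show ?thesis using False by (simp add: col_def)
  qed
  then have "s (f t) \<noteq> s (f (Suc t mod k))" if "t < k" for t
    using that sf by auto
  then have "inj_on s {f t, f (Suc t mod k)}" if "t < k" for t
    using that by auto
  then have "\<forall>e\<in>C. inj_on s e"
    unfolding f(3) cyc_def by blast
  moreover have "\<forall>v. s v < 3"
    by (auto simp: s_def col_def)
  ultimately show ?thesis by blast
qed

lemma cycle_factor_colouring:
  assumes "cycle_factor k V E F"
  shows "\<exists>s :: 'a \<Rightarrow> nat. (\<forall>v. s v < 3) \<and> (\<forall>e\<in>\<Union>F. inj_on s e)"
proof -
  note F = cycle_factorD[OF assms]
  have "\<forall>C\<in>F. \<exists>s :: 'a \<Rightarrow> nat. (\<forall>v. s v < 3) \<and> (\<forall>e\<in>C. inj_on s e)"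
    using F(3) cycle_colouring by blast
  then obtain S :: "'a set set \<Rightarrow> 'a \<Rightarrow> nat"
    where S: "\<And>C v. C \<in> F \<Longrightarrow> S C v < 3" "\<And>C e. C \<in> F \<Longrightarrow> e \<in> C \<Longrightarrow> inj_on (S C) e"
    by metis
  \<comment> \<open>The cycles are disjoint, so their colourings glue; 0 is a default outside
    \<open>V\<close>.\<close>
  define s where "s v = (if v \<in> V then S (THE C. C \<in> F \<and> v \<in> \<Union>C) v else 0)" for v
  have the: "(THE C. C \<in> F \<and> v \<in> \<Union>C) = C" if "C \<in> F" "v \<in> \<Union>C" for C v
    using that F(5) by (intro the_equality) blast+
  have inV: "\<exists>C\<in>F. v \<in> \<Union>C" if "v \<in> V" for v
    using that F(6) by blast
  have "s v < 3" for v
  proof (cases "v \<in> V")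
    case True
    then obtain C where "C \<in> F" "v \<in> \<Union>C" using inV by blast
    then show ?thesis using the[of C v] S(1) True by (simp add: s_def)
  qed (simp add: s_def)
  moreover have "inj_on s e" if e: "C \<in> F" "e \<in> C" for C e
  proof -
    have "s v = S C v" if "v \<in> e" for v
      using that e the[of C v] F(6) by (auto simp: s_def)
    then show ?thesis
      using S(2)[OF e] by (simp add: inj_on_def)
  qed
  ultimately show ?thesis by blast
qed

text \<open>Passing to integers avoids truncated subtraction when terms are cancelled in
  congruences.\<close>

lemma mod_add_eq_iff_dvd:
  fixes x y a b g :: nat
  shows "(x + a) mod g = (y + b) mod g \<longleftrightarrow> int g dvd (int x + int a) - (int y + int b)"
  by (metis mod_eq_dvd_iff of_nat_add of_nat_eq_iff of_nat_mod)

lemma dvd_diff_imp_eq: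
  fixes x y g :: nat
  assumes "int g dvd int x - int y" "x < g" "y < g"
  shows "x = y"
  using assms mod_add_eq_iff_dvd[of x 0 g y 0] by simp

lemma bij_betw_add_mod:
  fixes a g :: nat
  shows "bij_betw (\<lambda>x. (x + a) mod g) {..<g} {..<g}"
proof -
  have "inj_on (\<lambda>x. (x + a) mod g) {..<g}"
    by (rule inj_onI) (auto simp: mod_add_eq_iff_dvd intro: dvd_diff_imp_eq)
  moreover have "(\<lambda>x. (x + a) mod g) ` {..<g} \<subseteq> {..<g}"
    by auto
  ultimately show ?thesis
    by (metis bij_betw_def endo_inj_surj finite_lessThan)
qed

text \<open>Vertex \<open>u\<close> becomes \<open>{u} \<times> {..<g}\<close>. With a proper 3-colouring \<open>s\<close> of a factor, the parameter
  \<open>c\<close> selects the edges from \<open>(u, p)\<close> to \<open>(v, q)\<close> with \<open>q - p \<equiv> c (s v - s u)\<close> modulo \<open>g\<close>. As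
  \<open>s v - s u\<close> is a unit modulo the odd number \<open>g\<close>, distinct \<open>c\<close> give disjoint edge sets.\<close>

lemma decomposes_blow_up:
  assumes D: "decomposes k W D r" and "odd g"
  obtains D' where "decomposes k (W \<times> {..<g}) D' (r * g)" "\<And>e. e \<in> D' \<Longrightarrow> fst ` e \<in> D"
proof -
  obtain H where H: "\<And>i. i < r \<Longrightarrow> cycle_factor k W D (H i)"
      "disjoint_family_on (\<lambda>i. \<Union>(H i)) {..<r}" "D = (\<Union>i<r. \<Union>(H i))"
    using D by (rule decomposesE) blast
  have "\<forall>i\<in>{..<r}. \<exists>s :: 'a \<Rightarrow> nat. (\<forall>v. s v < 3) \<and> (\<forall>e\<in>\<Union>(H i). inj_on s e)"
    using cycle_factor_colouring[OF H(1)] by blast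
  from bchoice[OF this] obtain s :: "nat \<Rightarrow> 'a \<Rightarrow> nat"
    where "\<forall>i\<in>{..<r}. (\<forall>v. s i v < 3) \<and> (\<forall>e\<in>\<Union>(H i). inj_on (s i) e)"
    by (elim exE)
  then have s: "s i v < 3" "e \<in> \<Union>(H i) \<Longrightarrow> inj_on (s i) e" if "i < r" for i v e
    using that by blast+
  \<comment> \<open>For fixed \<open>i\<close> and \<open>c\<close> this is the copy of
    \<open>W\<close> with offset \<open>x\<close>. As \<open>x\<close> varies the copies tile
    \<open>W \<times> {..<g}\<close>, so each pair \<open>(i, c)\<close> yields one round.\<close>
  define \<phi> where "\<phi> i c x u = (u, (x + c * s i u) mod g)" for i c x u
  define F where "F p = (\<Union>x\<in>{..<g}. (\<lambda>C. (`) (\<phi> (fst p) (snd p) x) ` C) ` H (fst p))" for p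
  define B where "B p = (\<Union>x\<in>{..<g}. (`) (\<phi> (fst p) (snd p) x) ` \<Union>(H (fst p)))" for p
  have FB: "\<Union>(F p) = B p" for p
    unfolding F_def B_def by auto
  have VW: "(\<Union>x\<in>{..<g}. \<phi> i c x ` W) = W \<times> {..<g}" for i c
  proof -
    have "(u, y) \<in> (\<Union>x\<in>{..<g}. \<phi> i c x ` W)" if "u \<in> W" "y < g" for u y
    proof -
      have "y \<in> (\<lambda>x. (x + c * s i u) mod g) ` {..<g}"
        using bij_betw_add_mod[of "c * s i u" g] that by (simp add: bij_betw_def)
      then show ?thesis
        using that by (auto simp: \<phi>_def)
    qed
    moreover have "g > 0" using \<open>odd g\<close> by (cases g) auto
    ultimately show ?thesis by (auto simp: \<phi>_def)
  qed
  have fact: "cycle_factor k (W \<times> {..<g}) (B p) (F p)" if p: "p \<in> {..<r} \<times> {..<g}" for p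
    unfolding F_def B_def VW[of "fst p" "snd p", symmetric]
  proof (rule cycle_factor_images)
    show "cycle_factor k W D (H (fst p))" using p H(1) by auto
    show "inj_on (\<phi> (fst p) (snd p) x) W" for x
      by (auto simp: \<phi>_def inj_on_def)
    fix x y assume xy: "x \<in> {..<g}" "y \<in> {..<g}" "x \<noteq> y"
    have "(x + a) mod g \<noteq> (y + a) mod g" for a
      using xy dvd_diff_imp_eq[of g x y] by (auto simp: mod_add_eq_iff_dvd)
    then show "\<phi> (fst p) (snd p) x ` W \<inter> \<phi> (fst p) (snd p) y ` W = {}"
      by (auto simp: \<phi>_def)
  qed simp
  have fstB: "fst ` e \<in> \<Union>(H i)" if "e \<in> B (i, c)" for e i c
    using that by (auto simp: B_def \<phi>_def image_image)
  have "disjoint_family_on (\<lambda>p. \<Union>(F p)) ({..<r} \<times> {..<g})"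
    unfolding disjoint_family_on_def FB
  proof (intro ballI impI, rule ccontr)
    fix p q assume pq: "p \<in> {..<r} \<times> {..<g}" "q \<in> {..<r} \<times> {..<g}" "p \<noteq> q" "B p \<inter> B q \<noteq> {}"
    obtain i c j d where ij: "p = (i, c)" "q = (j, d)" "i < r" "j < r" "c < g" "d < g"
      using pq by auto
    obtain e where e: "e \<in> B (i, c)" "e \<in> B (j, d)"
      using pq ij by blast
    have "i = j"
      using fstB[OF e(1)] fstB[OF e(2)] ij H(2) by (auto simp: disjoint_family_on_def)
    obtain x a where a: "a \<in> \<Union>(H i)" "e = \<phi> i c x ` a"
      using e(1) by (auto simp: B_def)
    obtain y b where b: "b \<in> \<Union>(H i)" "e = \<phi> i d y ` b"
      using e(2) \<open>i = j\<close> by (auto simp: B_def)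
    have "fst ` \<phi> i' c' x' ` A = A" for i' c' x' and A :: "'a set"
      by (simp add: \<phi>_def image_image)
    then have "a = fst ` e" "b = fst ` e"
      using a(2) b(2) by metis+
    then have "b = a" by simp
    have "card a = 2"
      using cycle_factor_edges[OF H(1)[OF \<open>i < r\<close>]] a(1) by (auto simp: complete_edges_def)
    then obtain u v where uv: "a = {u, v}" "u \<noteq> v"
      by (auto simp: card_2_iff)
    have eq: "(x + c * s i w) mod g = (y + d * s i w) mod g" if "w \<in> a" for w
    proof -
      have "(w, (x + c * s i w) mod g) \<in> \<phi> i d y ` a"
        using that a(2) b(2) \<open>b = a\<close> by (auto simp: \<phi>_def)
      then show ?thesis by (auto simp: \<phi>_def)
    qed
    have "int g dvd (int x + int (c * s i u)) - (int y + int (d * s i u))"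
         "int g dvd (int x + int (c * s i v)) - (int y + int (d * s i v))"
      unfolding mod_add_eq_iff_dvd[symmetric] using eq uv by auto
    \<comment> \<open>Subtracting the congruences at the two ends of the edge eliminates the offsets
      \<open>x\<close> and \<open>y\<close>.\<close>
    then have "int g dvd ((int x + int (c * s i u)) - (int y + int (d * s i u)))
        - ((int x + int (c * s i v)) - (int y + int (d * s i v)))"
      by (rule dvd_diff)
    then have "int g dvd (int c - int d) * (int (s i u) - int (s i v))"
      by (simp add: algebra_simps)
    moreover have "coprime (int g) (int (s i u) - int (s i v))"
    proof -
      have "s i u \<noteq> s i v"
        using s(2)[OF \<open>i < r\<close> a(1)] uv by (simp add: inj_on_def)
      then have "int (s i u) - int (s i v) \<in> {1, -1, 2, -2}"
        using s(1)[OF \<open>i < r\<close>, of u] s(1)[OF \<open>i < r\<close>, of v] by auto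
      then show ?thesis
        using \<open>odd g\<close> by (auto simp: coprime_right_2_iff_odd)
    qed
    ultimately have "int g dvd int c - int d"
      by (simp add: coprime_dvd_mult_left_iff)
    then have "c = d"
      using ij by (auto intro: dvd_diff_imp_eq)
    then show False
      using pq(3) ij \<open>i = j\<close> by simp
  qed
  then have "decomposes k (W \<times> {..<g}) (\<Union>p\<in>{..<r} \<times> {..<g}. \<Union>(F p)) (r * g)"
    using fact by (intro decomposesI[where E = B]) auto
  moreover have "fst ` e \<in> D" if "e \<in> (\<Union>p\<in>{..<r} \<times> {..<g}. \<Union>(F p))" for e
    using that fstB unfolding FB H(3) by fastforce
  ultimately show ?thesis using that by blast
qed

section \<open>Hamiltonian decompositions\<close>

lemma Hamiltonian_cycle_factor:
  assumes "k \<ge> 3" "bij_betw f {..<k} V"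
  shows "cycle_factor k V (cyc k f) {cyc k f}"
  using assms by (intro cycle_factorI) (auto simp: bij_betw_def is_cycleI)

lemma decomposes_Hamiltonian:
  assumes "k \<ge> 3" "\<And>j. j < r \<Longrightarrow> bij_betw (f j) {..<k} V"
    and "\<And>i j e. i < r \<Longrightarrow> j < r \<Longrightarrow> e \<in> cyc k (f i) \<Longrightarrow> e \<in> cyc k (f j) \<Longrightarrow> i = j"
  shows "decomposes k V (\<Union>j<r. cyc k (f j)) r"
proof -
  have "decomposes k V (\<Union>j\<in>{..<r}. \<Union>{cyc k (f j)}) r"
    using assms(3) Hamiltonian_cycle_factor[OF assms(1,2)]
    by (intro decomposesI) (auto simp: disjoint_family_on_def)
  then show ?thesis by simp
qed

text \<open>Walecki's zigzag cycles: the vertex \<open>2 * h\<close> plays the role of infinity, and the edges of the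
  \<open>j\<close>-th cycle avoiding it are those whose ends have sum \<open>2 * j\<close> or \<open>2 * j + 1\<close> modulo \<open>2 * h\<close>.\<close>

lemma decomposes_complete_odd:
  assumes "h \<ge> 1"
  obtains D where "decomposes (2 * h + 1) {..<2 * h + 1} D h"
proof -
  let ?k = "2 * h + 1"
  \<comment> \<open>The zigzag \<open>j, j + 1, j - 1, j + 2, ..., j + h\<close> modulo
    \<open>2 * h\<close>, then infinity; \<open>2 * h - t div 2\<close> stands for
    \<open>- (t div 2)\<close>.\<close>
  define z where "z j t = (if t = 2 * h then 2 * h
      else (j + (if odd t then (t + 1) div 2 else 2 * h - t div 2)) mod (2 * h))" for j t :: nat
  have zlt: "z j t < 2 * h" if "t < 2 * h" for j t
    using that assms by (simp add: z_def)
  have bij: "bij_betw (z j) {..<?k} {..<?k}" for j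
  proof -
    have "inj_on (z j) {..<?k}"
    proof (rule inj_onI)
      fix t t' assume tt: "t \<in> {..<?k}" "t' \<in> {..<?k}" "z j t = z j t'"
      show "t = t'"
      proof (cases "t = 2 * h \<or> t' = 2 * h")
        case True
        have z2: "z j (2 * h) = 2 * h" by (simp add: z_def)
        then have "z j x = 2 * h \<longleftrightarrow> x = 2 * h" if "x < ?k" for x
          using zlt[of x j] that by (cases "x = 2 * h") auto
        then show ?thesis
          using tt True z2 by (metis lessThan_iff)
      next
        case False
        \<comment> \<open>These offsets range over \<open>1..2 * h\<close>, not
          \<open>0..2 * h - 1\<close>, hence the shift by one below.\<close>
        define o1 where "o1 t = (if odd t then (t + 1) div 2 else 2 * h - t div 2)" for t
        have lt: "t < 2 * h" "t' < 2 * h" using False tt by auto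
        have o1: "1 \<le> o1 t \<and> o1 t \<le> 2 * h" if "t < 2 * h" for t
          using that by (auto simp: o1_def)
        have "(o1 t + j) mod (2 * h) = (o1 t' + j) mod (2 * h)"
          using tt False by (simp add: z_def o1_def add.commute)
        then have "int (2 * h) dvd int (o1 t) - int (o1 t')"
          by (simp add: mod_add_eq_iff_dvd)
        then have "int (2 * h) dvd int (o1 t - 1) - int (o1 t' - 1)"
          using o1[OF lt(1)] o1[OF lt(2)] by (simp add: of_nat_diff)
        then have "o1 t - 1 = o1 t' - 1"
          using o1[OF lt(1)] o1[OF lt(2)] assms by (intro dvd_diff_imp_eq[of "2 * h"]) auto
        then have "o1 t = o1 t'"
          using o1[OF lt(1)] o1[OF lt(2)] by linarith
        then show ?thesis
          using lt unfolding o1_def by (auto split: if_splits elim!: oddE evenE)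
      qed
    qed
    moreover have "z j ` {..<?k} \<subseteq> {..<?k}"
    proof
      fix x assume "x \<in> z j ` {..<?k}"
      then obtain t where "t < ?k" "x = z j t" by auto
      then show "x \<in> {..<?k}"
        using zlt[of t j] by (cases "t = 2 * h") (simp_all add: z_def[of j "2 * h"])
    qed
    ultimately show ?thesis
      by (metis bij_betw_def endo_inj_surj finite_lessThan)
  qed
  \<comment> \<open>Each edge determines \<open>j < h\<close>: by half the residue of its sum, or by
    the neighbour \<open>j\<close> or \<open>j + h\<close> of infinity.\<close>
  have key: "(\<exists>u v. e = {u, v} \<and> u < 2 * h \<and> v < 2 * h \<and> (u + v) mod (2 * h) div 2 = j) \<or>
      e = {2 * h, j} \<or> e = {2 * h, j + h}" if j: "j < h" and e: "e \<in> cyc ?k (z j)" for j e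
  proof -
    obtain t where t: "t < ?k" "e = {z j t, z j (Suc t mod ?k)}"
      using e by (auto simp: cyc_def)
    consider "t = 2 * h" | "t = 2 * h - 1" | "t < 2 * h - 1"
      using t(1) by linarith
    then show ?thesis
    proof cases
      case 1
      then have "z j (Suc t mod ?k) = j" "z j t = 2 * h"
        using j assms by (auto simp: z_def)
      then show ?thesis using t by auto
    next
      case 2
      then have "Suc t mod ?k = 2 * h" "odd t" "t \<noteq> 2 * h" "(t + 1) div 2 = h"
        using assms by auto
      then have "z j (Suc t mod ?k) = 2 * h" "z j t = j + h"
        using j by (auto simp: z_def)
      then show ?thesis using t by auto
    next
      case 3
      then have st: "Suc t mod ?k = Suc t" "t < 2 * h" "Suc t < 2 * h" by auto
      have "(z j t + z j (Suc t)) mod (2 * h) div 2 = j"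
      proof (cases "even t")
        case True
        then obtain a where a: "t = 2 * a" by blast
        have "(z j t + z j (Suc t)) mod (2 * h) = ((j + (2 * h - a)) + (j + (a + 1))) mod (2 * h)"
          using a st by (simp add: z_def mod_add_eq)
        also have "(j + (2 * h - a)) + (j + (a + 1)) = (2 * j + 1) + 2 * h"
          using a st by simp
        also have "((2 * j + 1) + 2 * h) mod (2 * h) = 2 * j + 1"
          using j by (simp only: mod_add_self2) simp
        finally show ?thesis by simp
      next
        case False
        then obtain a where a: "t = 2 * a + 1" by (blast elim: oddE)
        have "(z j t + z j (Suc t)) mod (2 * h) = ((j + (a + 1)) + (j + (2 * h - (a + 1)))) mod (2 * h)"
          using a st by (simp add: z_def mod_add_eq)
        also have "(j + (a + 1)) + (j + (2 * h - (a + 1))) = 2 * j + 2 * h"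
          using a st by simp
        also have "(2 * j + 2 * h) mod (2 * h) = 2 * j"
          using j by simp
        finally show ?thesis by simp
      qed
      then show ?thesis
        using t st zlt by (metis (no_types))
    qed
  qed
  have "decomposes ?k {..<?k} (\<Union>j<h. cyc ?k (z j)) h"
  proof (rule decomposes_Hamiltonian)
    fix i j e assume ij: "i < h" "j < h" and e: "e \<in> cyc ?k (z i)" "e \<in> cyc ?k (z j)"
    from key[OF ij(1) e(1)] key[OF ij(2) e(2)] ij show "i = j"
      by (auto simp: doubleton_eq_iff add.commute)
  qed (use assms bij in auto)
  then show ?thesis using that by blast
qed

section \<open>Hamiltonian cycles in the complete bipartite graph\<close>

definition bip :: "nat \<Rightarrow> (bool \<times> nat) set" where
  "bip m = UNIV \<times> {..<m}"

definition bip_edge :: "nat \<Rightarrow> nat \<Rightarrow> (bool \<times> nat) set" where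
  "bip_edge x y = {(False, x), (True, y)}"

lemma bip_edge_eq_iff [simp]: "bip_edge x y = bip_edge x' y' \<longleftrightarrow> x = x' \<and> y = y'"
  by (auto simp: bip_edge_def doubleton_eq_iff)

text \<open>The \<open>j\<close>-th cycle uses the differences \<open>2 * j + 1\<close> and \<open>2 * j + 2\<close> modulo \<open>l\<close>, so for odd \<open>l\<close>
  the difference \<open>0\<close> remains unused.\<close>

lemma decomposes_bipartite:
  assumes "l \<ge> 2"
  obtains D where "decomposes (2 * l) (bip l) D (l div 2)"
    "\<And>e. e \<in> D \<Longrightarrow> \<exists>x<l. \<exists>y<l. e = bip_edge x y \<and> (odd l \<longrightarrow> x \<noteq> y)"
proof -
  \<comment> \<open>Position \<open>2 * a\<close> is \<open>a\<close> on one side, and position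
    \<open>2 * a + 1\<close> is \<open>a + 2 * j + 2\<close> on the other. Seen from
    \<open>a\<close> the edge has difference \<open>2 * j + 2\<close>; seen from the next vertex
    \<open>a + 1\<close> it has \<open>2 * j + 1\<close>.\<close>
  define f where "f j t = (if even t then (False, t div 2) else (True, (t div 2 + (2 * j + 2)) mod l))"
    for j t :: nat
  have bij: "bij_betw (f j) {..<2 * l} (bip l)" for j
  proof -
    have "inj_on (f j) {..<2 * l}"
    proof (rule inj_onI)
      fix t t' assume tt: "t \<in> {..<2 * l}" "t' \<in> {..<2 * l}" "f j t = f j t'"
      have "t div 2 = t' div 2" if "odd t" "odd t'"
      proof -
        have "(t div 2 + (2 * j + 2)) mod l = (t' div 2 + (2 * j + 2)) mod l"
          using tt that by (simp add: f_def)
        then have "int l dvd int (t div 2) - int (t' div 2)"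
          by (simp only: mod_add_eq_iff_dvd) simp
        then show ?thesis
          using tt by (intro dvd_diff_imp_eq[of l]) auto
      qed
      then show "t = t'"
        using tt by (auto simp: f_def split: if_splits elim!: evenE oddE)
    qed
    moreover have "f j ` {..<2 * l} \<subseteq> bip l"
      using assms by (auto simp: f_def bip_def)
    moreover have "card (bip l) = 2 * l"
      by (simp add: bip_def card_cartesian_product)
    moreover have "finite (bip l)" by (simp add: bip_def)
    ultimately show ?thesis
      by (metis bij_betw_def card_image card_lessThan card_subset_eq)
  qed
  have key: "\<exists>x<l. \<exists>d\<in>{2 * j + 1, 2 * j + 2}. e = bip_edge x ((x + d) mod l)"
    if e: "e \<in> cyc (2 * l) (f j)" for e j
  proof -
    obtain t where t: "t < 2 * l" "e = {f j t, f j (Suc t mod (2 * l))}"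
      using e by (auto simp: cyc_def)
    show ?thesis
    proof (cases "even t")
      case True
      then obtain a where a: "t = 2 * a" by blast
      then have "Suc t mod (2 * l) = Suc (2 * a)" "a < l" using t by auto
      then have "e = bip_edge a ((a + (2 * j + 2)) mod l)"
        using a t by (simp add: f_def bip_edge_def)
      then show ?thesis using \<open>a < l\<close> by blast
    next
      case False
      then obtain a where a: "t = 2 * a + 1" by (blast elim: oddE)
      have al: "a < l" using a t by simp
      have "Suc t mod (2 * l) = 2 * (Suc a mod l)"
        using a by (metis Suc_eq_plus1 add_Suc_right mult_Suc_right mult_mod_right one_add_one plus_1_eq_Suc add.assoc add.commute)
      then have "e = bip_edge (Suc a mod l) ((a + (2 * j + 2)) mod l)"
        using a t by (auto simp: f_def bip_edge_def)
      moreover have "(a + (2 * j + 2)) mod l = (Suc a mod l + (2 * j + 1)) mod l"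
        by (subst mod_add_left_eq) simp
      moreover have "Suc a mod l < l" using assms by simp
      ultimately show ?thesis
        by (intro exI[of _ "Suc a mod l"] conjI bexI[of _ "2 * j + 1"]) simp_all
    qed
  qed
  \<comment> \<open>Differences are represented in \<open>1..l\<close>, because for even
    \<open>l\<close> the last cycle uses the difference \<open>l\<close> itself.\<close>
  have d_inj: "d = d'"
    if "1 \<le> d" "d \<le> l" "1 \<le> d'" "d' \<le> l" "(x + d) mod l = (x + d') mod l" for x d d'
  proof -
    have "int l dvd int d - int d'"
      using that(5) by (simp add: mod_add_eq_iff_dvd)
    then have "int l dvd int (d - 1) - int (d' - 1)"
      using that by (simp add: of_nat_diff)
    then have "d - 1 = d' - 1"
      using that by (intro dvd_diff_imp_eq[of l]) auto
    then show ?thesis using that by simp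
  qed
  have le: "2 * j + 2 \<le> l" if "j < l div 2" for j
    using that by linarith
  have "decomposes (2 * l) (bip l) (\<Union>j<l div 2. cyc (2 * l) (f j)) (l div 2)"
  proof (rule decomposes_Hamiltonian)
    fix i j e assume ij: "i < l div 2" "j < l div 2"
      and e: "e \<in> cyc (2 * l) (f i)" "e \<in> cyc (2 * l) (f j)"
    obtain x d where xd: "d \<in> {2 * i + 1, 2 * i + 2}" "e = bip_edge x ((x + d) mod l)"
      using key[OF e(1)] by blast
    obtain x' d' where xd': "d' \<in> {2 * j + 1, 2 * j + 2}" "e = bip_edge x' ((x' + d') mod l)"
      using key[OF e(2)] by blast
    have "x = x'" "(x + d) mod l = (x + d') mod l"
      using xd xd' by auto
    then have "d = d'"
      using xd(1) xd'(1) le[OF ij(1)] le[OF ij(2)] by (intro d_inj[of d d' x]) auto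
    then show "i = j"
      using xd(1) xd'(1) by auto
  qed (use assms bij in auto)
  moreover have "\<exists>x<l. \<exists>y<l. e = bip_edge x y \<and> (odd l \<longrightarrow> x \<noteq> y)"
    if e: "e \<in> (\<Union>j<l div 2. cyc (2 * l) (f j))" for e
  proof -
    obtain j where j: "j < l div 2" "e \<in> cyc (2 * l) (f j)" using e by auto
    obtain x d where xd: "x < l" "d \<in> {2 * j + 1, 2 * j + 2}" "e = bip_edge x ((x + d) mod l)"
      using key[OF j(2)] by blast
    have "x \<noteq> (x + d) mod l" if "odd l"
    proof
      assume "x = (x + d) mod l"
      then have "(x + d) mod l = (x + l) mod l"
        using xd by simp
      then have "d = l"
        using xd(2) le[OF j(1)] by (intro d_inj[of d l x]) auto
      moreover have "2 * j + 2 < l" using j(1) \<open>odd l\<close> le[OF j(1)] by (cases "2 * j + 2 = l") auto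
      ultimately show False using xd(2) by auto
    qed
    then show ?thesis using xd assms by (metis mod_less_divisor less_le_trans zero_less_numeral)
  qed
  ultimately show ?thesis using that by blast
qed

section \<open>Blocks of numbers and iterated blow-ups\<close>

lemma bij_betw_block:
  fixes g k :: nat
  shows "bij_betw (\<lambda>(i, x). i * g + x) ({..<k} \<times> {..<g}) {..<k * g}"
proof (rule bij_betwI[where g = "\<lambda>y. (y div g, y mod g)"])
  show "(\<lambda>(i, x). i * g + x) \<in> {..<k} \<times> {..<g} \<rightarrow> {..<k * g}"
  proof safe
    fix i x assume "i < k" "x < g"
    then have "i * g + x < Suc i * g" by simp
    also have "\<dots> \<le> k * g" using \<open>i < k\<close> by (intro mult_right_mono) auto
    finally show "i * g + x < k * g" .
  qed
  show "(\<lambda>y. (y div g, y mod g)) \<in> {..<k * g} \<rightarrow> {..<k} \<times> {..<g}"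
    by (cases "g = 0") (auto simp: less_mult_imp_div_less)
qed auto

lemma disjoint_blocks:
  fixes g i j :: nat
  assumes "i \<noteq> j"
  shows "(\<lambda>x. i * g + x) ` {..<g} \<inter> (\<lambda>x. j * g + x) ` {..<g} = {}"
proof -
  have "(i * g + x) div g = i" if "x < g" for x i
    using that by simp
  then have "i = j" if "i * g + x = j * g + y" "x < g" "y < g" for x y
    using that by metis
  then show ?thesis using assms by blast
qed

lemma UN_block:
  fixes g k :: nat
  shows "(\<Union>i\<in>{..<k}. (\<lambda>x. i * g + x) ` {..<g}) = {..<k * g}"
proof -
  have "(\<Union>i\<in>{..<k}. (\<lambda>x. i * g + x) ` {..<g}) = (\<lambda>(i, x). i * g + x) ` ({..<k} \<times> {..<g})"
    by force
  then show ?thesis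
    using bij_betw_block[of g k] by (simp add: bij_betw_def)
qed

text \<open>The blow-up of the Hamiltonian decomposition, with \<open>(i, x)\<close> coded as
  \<open>i * g + x\<close>. Injectivity of \<open>div g\<close> on an edge records that it joins
  different parts; the edges inside parts stay free for other rounds.\<close>

lemma decomposes_multipartite:
  assumes "h \<ge> 1" "odd g"
  obtains D where "decomposes (2 * h + 1) {..<(2 * h + 1) * g} D (h * g)"
    "\<And>e. e \<in> D \<Longrightarrow> inj_on (\<lambda>x. x div g) e"
proof -
  let ?k = "2 * h + 1"
  let ?\<beta> = "\<lambda>(i, x). i * g + x"
  obtain D0 where D0: "decomposes ?k {..<?k} D0 h"
    using decomposes_complete_odd[OF assms(1)] by blast
  obtain D1 where D1: "decomposes ?k ({..<?k} \<times> {..<g}) D1 (h * g)" "\<And>e. e \<in> D1 \<Longrightarrow> fst ` e \<in> D0"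
    using decomposes_blow_up[OF D0 assms(2)] by blast
  have \<beta>: "inj_on ?\<beta> ({..<?k} \<times> {..<g})" "?\<beta> ` ({..<?k} \<times> {..<g}) = {..<?k * g}"
    using bij_betw_block[of g ?k] by (auto simp: bij_betw_def)
  have D2: "decomposes ?k {..<?k * g} ((`) ?\<beta> ` D1) (h * g)"
    using decomposes_image[OF D1(1) \<beta>(1)] unfolding \<beta>(2) .
  moreover have "inj_on (\<lambda>x. x div g) e" if "e \<in> (`) ?\<beta> ` D1" for e
  proof -
    obtain e' where e': "e' \<in> D1" "e = ?\<beta> ` e'" using \<open>e \<in> (`) ?\<beta> ` D1\<close> by blast
    have "e' \<subseteq> {..<?k} \<times> {..<g}"
      using decomposes_edges[OF D1(1)] e' by (auto simp: complete_edges_def)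
    then have "?\<beta> p div g = fst p" if "p \<in> e'" for p
      using that by auto
    then have "(\<lambda>x. x div g) ` e = fst ` e'"
      unfolding e'(2) image_image by (intro image_cong) auto
    moreover have "card (fst ` e') = 2"
      using decomposes_edges[OF D0] D1(2)[OF e'(1)] by (auto simp: complete_edges_def)
    moreover have "card e = 2"
      using decomposes_edges[OF D2] that by (auto simp: complete_edges_def)
    ultimately show ?thesis
      by (metis card.infinite eq_card_imp_inj_on zero_neq_numeral)
  qed
  ultimately show ?thesis using that by blast
qed

text \<open>With \<open>2 * h + 1\<close> parts of size \<open>g = (2 * h + 1) ^ j\<close>, the
  edges between parts take \<open>h * g\<close> rounds; the induction hypothesis then handles all
  parts in parallel in \<open>(g - 1) div 2\<close> more.\<close>

lemma decomposes_complete_power: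
  assumes "h \<ge> 1"
  obtains D where "decomposes (2 * h + 1) {..<(2 * h + 1) ^ j} D (((2 * h + 1) ^ j - 1) div 2)"
proof -
  let ?k = "2 * h + 1"
  have "\<exists>D. decomposes ?k {..<?k ^ j} D ((?k ^ j - 1) div 2)"
  proof (induction j)
    case 0
    show ?case using decomposes_0 by auto
  next
    case (Suc j)
    define g where "g = ?k ^ j"
    have g: "odd g" by (simp add: g_def)
    obtain D where D: "decomposes ?k {..<g} D ((g - 1) div 2)" using Suc unfolding g_def by blast
    obtain D1 where D1: "decomposes ?k {..<?k * g} D1 (h * g)"
        "\<And>e. e \<in> D1 \<Longrightarrow> inj_on (\<lambda>x. x div g) e"
      using decomposes_multipartite[OF assms g] by blast
    define D2 where "D2 = (\<Union>i\<in>{..<?k}. (`) (\<lambda>x. i * g + x) ` D)"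
    have D2: "decomposes ?k {..<?k * g} D2 ((g - 1) div 2)"
      unfolding D2_def UN_block[symmetric]
    proof (rule decomposes_images[OF D])
      fix i i' :: nat assume "i \<noteq> i'"
      then show "(\<lambda>x. i * g + x) ` {..<g} \<inter> (\<lambda>x. i' * g + x) ` {..<g} = {}"
        by (rule disjoint_blocks)
    qed auto
    have "\<not> inj_on (\<lambda>x. x div g) e" if "e \<in> D2" for e
    proof -
      obtain i e' where e': "e' \<in> D" "e = (\<lambda>x. i * g + x) ` e'"
        using \<open>e \<in> D2\<close> by (auto simp: D2_def)
      then have "e' \<subseteq> {..<g}" "card e' = 2"
        using decomposes_edges[OF D] by (auto simp: complete_edges_def)
      then obtain u v where "e' = {u, v}" "u \<noteq> v" "u < g" "v < g"
        by (auto simp: card_2_iff)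
      then show ?thesis unfolding e'(2) by (auto simp: inj_on_def)
    qed
    then have "D1 \<inter> D2 = {}" using D1(2) by blast
    then have "decomposes ?k {..<?k * g} (D1 \<union> D2) (h * g + (g - 1) div 2)"
      by (rule decomposes_add[OF D1(1) D2])
    moreover obtain a where "g = 2 * a + 1" using g by (rule oddE)
    then have "h * g + (g - 1) div 2 = (?k * g - 1) div 2"
      by (simp add: algebra_simps)
    ultimately show ?case unfolding g_def power_Suc by auto
  qed
  then show ?thesis using that by blast
qed

text \<open>Keeping the edge below each new edge in the conclusion lets an edge missing from
  \<open>D\<close> exclude a whole pair of blocks.\<close>

lemma decomposes_bip_blow_up:
  assumes D: "decomposes k (bip l) D r" and "odd g"
    and bip: "\<And>e. e \<in> D \<Longrightarrow> \<exists>x y. e = bip_edge x y"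
  obtains D' where "decomposes k (bip (l * g)) D' (r * g)"
    "\<And>e. e \<in> D' \<Longrightarrow> \<exists>x<l * g. \<exists>y<l * g. e = bip_edge x y \<and> bip_edge (x div g) (y div g) \<in> D"
proof -
  obtain D1 where D1: "decomposes k (bip l \<times> {..<g}) D1 (r * g)" "\<And>e. e \<in> D1 \<Longrightarrow> fst ` e \<in> D"
    using decomposes_blow_up[OF D assms(2)] by blast
  define \<beta> :: "(bool \<times> nat) \<times> nat \<Rightarrow> bool \<times> nat" where "\<beta> = (\<lambda>((b, i), x). (b, i * g + x))"
  have fact: "inj_on \<beta> (bip l \<times> {..<g})" "\<beta> ` (bip l \<times> {..<g}) = bip (l * g)"
  proof -
    have B: "inj_on (\<lambda>(i, x). i * g + x) ({..<l} \<times> {..<g})"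
        "(\<lambda>(i, x). i * g + x) ` ({..<l} \<times> {..<g}) = {..<l * g}"
      using bij_betw_block[of g l] by (auto simp: bij_betw_def)
    show "inj_on \<beta> (bip l \<times> {..<g})"
      using B(1) by (force simp: \<beta>_def bip_def inj_on_def)
    have "\<beta> ` (bip l \<times> {..<g}) = UNIV \<times> ((\<lambda>(i, x). i * g + x) ` ({..<l} \<times> {..<g}))"
      by (force simp: \<beta>_def bip_def)
    then show "\<beta> ` (bip l \<times> {..<g}) = bip (l * g)"
      unfolding B(2) by (simp add: bip_def)
  qed
  have D2: "decomposes k (bip (l * g)) ((`) \<beta> ` D1) (r * g)"
    using decomposes_image[OF D1(1) fact(1)] unfolding fact(2) .
  moreover have "\<exists>x<l * g. \<exists>y<l * g. e = bip_edge x y \<and> bip_edge (x div g) (y div g) \<in> D"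
    if e: "e \<in> (`) \<beta> ` D1" for e
  proof -
    obtain e' where e': "e' \<in> D1" "e = \<beta> ` e'" using e by blast
    have sub: "e' \<subseteq> bip l \<times> {..<g}" "card e' = 2"
      using decomposes_edges[OF D1(1)] e' by (auto simp: complete_edges_def)
    obtain x y where xy: "fst ` e' = bip_edge x y" "bip_edge x y \<in> D"
      using bip[OF D1(2)[OF e'(1)]] D1(2)[OF e'(1)] by metis
    have "(False, x) \<in> fst ` e'" "(True, y) \<in> fst ` e'"
      unfolding xy(1) by (auto simp: bip_edge_def)
    then obtain p q where pq: "((False, x), p) \<in> e'" "((True, y), q) \<in> e'"
      by force
    then have "{((False, x), p), ((True, y), q)} = e'"
      using sub(2) by (intro card_subset_eq) (auto intro: card_ge_0_finite)
    then have "e = bip_edge (x * g + p) (y * g + q)"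
      unfolding e'(2) by (auto simp: bip_edge_def \<beta>_def)
    moreover have "p < g" "q < g"
      using pq sub(1) by auto
    then have "(x * g + p) div g = x" "(y * g + q) div g = y"
      by simp_all
    moreover have "e \<subseteq> bip (l * g)"
      using decomposes_edges[OF D2] e by (auto simp: complete_edges_def)
    moreover have "x * g + p < l * g" "y * g + q < l * g"
      using calculation by (simp_all add: bip_edge_def bip_def)
    ultimately show ?thesis
      using xy(2) \<open>(x * g + p) div g = x\<close> \<open>(y * g + q) div g = y\<close> by metis
  qed
  ultimately show ?thesis using that by blast
qed

lemma card_bip: "card (bip m) = 2 * m"
  by (simp add: bip_def card_cartesian_product)

lemma finite_bip: "finite (bip m)"
  by (simp add: bip_def)

text \<open>For even \<open>l\<close> all cyclic differences occur, so one blow-up suffices: with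
  \<open>m = l * p\<close>, its \<open>l div 2 * p\<close> rounds of \<open>2 * m\<close> edges make
  up all \<open>m * m\<close> edges.\<close>

lemma decomposes_complete_bipartite:
  assumes "even l" "l \<ge> 2" "odd p"
  shows "decomposes (2 * l) (bip (l * p)) {bip_edge x y | x y. x < l * p \<and> y < l * p} (l * p div 2)"
proof -
  let ?m = "l * p"
  let ?E = "{bip_edge x y | x y. x < ?m \<and> y < ?m}"
  obtain D0 where D0: "decomposes (2 * l) (bip l) D0 (l div 2)"
      "\<And>e. e \<in> D0 \<Longrightarrow> \<exists>x y. e = bip_edge x y"
    using decomposes_bipartite[OF assms(2)] by metis
  obtain D where D: "decomposes (2 * l) (bip ?m) D (l div 2 * p)"
      "\<And>e. e \<in> D \<Longrightarrow> \<exists>x<?m. \<exists>y<?m. e = bip_edge x y"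
    using decomposes_bip_blow_up[OF D0(1) assms(3) D0(2)] by metis
  have "?E = (\<lambda>(x, y). bip_edge x y) ` ({..<?m} \<times> {..<?m})"
    by auto
  moreover have "inj_on (\<lambda>(x, y). bip_edge x y) ({..<?m} \<times> {..<?m})"
    by (auto simp: inj_on_def)
  ultimately have "card ?E = ?m * ?m" "finite ?E"
    by (simp_all add: card_image card_cartesian_product)
  moreover have "l div 2 * p * (2 * ?m) = ?m * ?m"
    using assms(1) by (elim evenE) simp
  moreover have "D \<subseteq> ?E" using D(2) by blast
  ultimately have "D = ?E"
    by (intro decomposes_eq[OF D(1)]) (simp_all only: card_bip)
  moreover have "l div 2 * p = l * p div 2"
    using assms(1) by (elim evenE) simp
  ultimately show ?thesis using D(1) by simp
qed

text \<open>For odd \<open>l\<close> the blow-up omits the pairs of blocks with equal number. These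
  are filled recursively and in parallel, until only the edges with \<open>x = y\<close> are
  missing; the edge count confirms that nothing else is.\<close>

lemma decomposes_bipartite_minus_matching:
  assumes "odd l" "l \<ge> 2"
  shows "decomposes (2 * l) (bip (l ^ j)) {bip_edge x y | x y. x < l ^ j \<and> y < l ^ j \<and> x \<noteq> y}
    ((l ^ j - 1) div 2)"
proof -
  have "\<exists>D. decomposes (2 * l) (bip (l ^ j)) D ((l ^ j - 1) div 2) \<and>
    (\<forall>e\<in>D. \<exists>x<l ^ j. \<exists>y<l ^ j. e = bip_edge x y \<and> x \<noteq> y)"
  proof (induction j)
    case 0
    show ?case using decomposes_0[of "2 * l" "bip 1"] by auto
  next
    case (Suc j)
    define g where "g = l ^ j"
    have g: "odd g" using assms by (simp add: g_def)
    obtain D where D: "decomposes (2 * l) (bip g) D ((g - 1) div 2)"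
        "\<forall>e\<in>D. \<exists>x<g. \<exists>y<g. e = bip_edge x y \<and> x \<noteq> y"
      using Suc unfolding g_def by (elim exE conjE)
    obtain D0 where D0: "decomposes (2 * l) (bip l) D0 (l div 2)"
        "\<And>e. e \<in> D0 \<Longrightarrow> \<exists>x<l. \<exists>y<l. e = bip_edge x y \<and> (odd l \<longrightarrow> x \<noteq> y)"
      using decomposes_bipartite[OF assms(2)] by blast
    have "\<exists>x y. e = bip_edge x y" if "e \<in> D0" for e using D0(2)[OF that] by blast
    from decomposes_bip_blow_up[OF D0(1) g this]
    obtain D1 where D1: "decomposes (2 * l) (bip (l * g)) D1 (l div 2 * g)"
        "\<And>e. e \<in> D1 \<Longrightarrow> \<exists>x<l * g. \<exists>y<l * g. e = bip_edge x y \<and> bip_edge (x div g) (y div g) \<in> D0"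
      by blast
    have D1': "\<exists>x<l * g. \<exists>y<l * g. e = bip_edge x y \<and> x div g \<noteq> y div g" if e: "e \<in> D1" for e
    proof -
      obtain x y where xy: "x < l * g" "y < l * g" "e = bip_edge x y" "bip_edge (x div g) (y div g) \<in> D0"
        using D1(2)[OF e] by blast
      have "x div g \<noteq> y div g"
        using D0(2)[OF xy(4)] assms(1) by auto
      then show ?thesis using xy by blast
    qed
    define \<phi> :: "nat \<Rightarrow> bool \<times> nat \<Rightarrow> bool \<times> nat" where "\<phi> i = apsnd (\<lambda>x. i * g + x)" for i
    define D2 where "D2 = (\<Union>i\<in>{..<l}. (`) (\<phi> i) ` D)"
    have \<phi>img: "\<phi> i ` bip g = UNIV \<times> (\<lambda>x. i * g + x) ` {..<g}" for i
      by (force simp: \<phi>_def bip_def)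
    have "bip (l * g) = (\<Union>i\<in>{..<l}. \<phi> i ` bip g)"
    proof -
      have "(\<Union>i\<in>{..<l}. \<phi> i ` bip g) = UNIV \<times> (\<Union>i\<in>{..<l}. (\<lambda>x. i * g + x) ` {..<g})"
        unfolding \<phi>img by auto
      then show ?thesis by (simp only: UN_block bip_def)
    qed
    moreover have "decomposes (2 * l) (\<Union>i\<in>{..<l}. \<phi> i ` bip g) D2 ((g - 1) div 2)"
      unfolding D2_def
    proof (rule decomposes_images[OF D(1)])
      fix i i' :: nat assume "i \<noteq> i'"
      then show "\<phi> i ` bip g \<inter> \<phi> i' ` bip g = {}"
        unfolding \<phi>img using disjoint_blocks[of i i' g] by blast
    qed (auto simp: \<phi>_def inj_on_def)
    ultimately have D2: "decomposes (2 * l) (bip (l * g)) D2 ((g - 1) div 2)"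
      by simp
    have D2': "\<exists>x<l * g. \<exists>y<l * g. e = bip_edge x y \<and> x \<noteq> y \<and> x div g = y div g"
      if e: "e \<in> D2" for e
    proof -
      obtain i e' where e': "e' \<in> D" "e = \<phi> i ` e'"
        using e by (auto simp: D2_def)
      obtain x y where "x < g" "y < g" "x \<noteq> y" "e' = bip_edge x y"
        using D(2) e'(1) by blast
      moreover from this have "e = bip_edge (i * g + x) (i * g + y)"
        unfolding e'(2) by (simp add: bip_edge_def \<phi>_def)
      moreover from this have "i * g + x < l * g" "i * g + y < l * g"
        using decomposes_edges[OF D2] e by (auto simp: complete_edges_def bip_edge_def bip_def)
      ultimately show ?thesis
        by (intro exI[of _ "i * g + x"] exI[of _ "i * g + y"] conjI) simp_all
    qed
    have "D1 \<inter> D2 = {}"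
      using D1' D2' by fastforce
    then have "decomposes (2 * l) (bip (l * g)) (D1 \<union> D2) (l div 2 * g + (g - 1) div 2)"
      by (rule decomposes_add[OF D1(1) D2])
    moreover have "l div 2 * g + (g - 1) div 2 = (l * g - 1) div 2"
    proof -
      obtain a b where "g = 2 * a + 1" "l = 2 * b + 1" using g assms(1) by (metis oddE)
      then have "l div 2 = b" "(g - 1) div 2 = a" "l * g = 2 * (b * g + a) + 1"
        by (simp_all add: algebra_simps)
      then show ?thesis by simp
    qed
    moreover have "\<exists>x<l * g. \<exists>y<l * g. e = bip_edge x y \<and> x \<noteq> y" if "e \<in> D1 \<union> D2" for e
      using that D1' D2' by blast
    ultimately show ?case
      unfolding g_def power_Suc by (intro exI[of _ "D1 \<union> D2"] conjI ballI) simp_all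
  qed
  then obtain D where D: "decomposes (2 * l) (bip (l ^ j)) D ((l ^ j - 1) div 2)"
    "\<forall>e\<in>D. \<exists>x<l ^ j. \<exists>y<l ^ j. e = bip_edge x y \<and> x \<noteq> y"
    by (elim exE conjE)
  let ?m = "l ^ j"
  let ?E = "{bip_edge x y | x y. x < ?m \<and> y < ?m \<and> x \<noteq> y}"
  let ?P = "{..<?m} \<times> {..<?m} - (\<lambda>x. (x, x)) ` {..<?m}"
  have "?E = (\<lambda>(x, y). bip_edge x y) ` ?P"
    by auto
  moreover have "inj_on (\<lambda>(x, y). bip_edge x y) ?P"
    by (auto simp: inj_on_def)
  moreover have "card ?P = ?m * ?m - ?m"
    by (subst card_Diff_subset) (auto simp: card_cartesian_product card_image inj_on_def)
  ultimately have "card ?E = ?m * ?m - ?m" "finite ?E"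
    by (simp_all add: card_image)
  moreover have "(?m - 1) div 2 * (2 * ?m) = ?m * ?m - ?m"
  proof -
    have "odd ?m" using assms(1) by simp
    then obtain a where "?m = 2 * a + 1" by (rule oddE)
    then show ?thesis by (simp add: algebra_simps)
  qed
  moreover have "D \<subseteq> ?E" using D(2) by blast
  ultimately have "D = ?E"
    by (intro decomposes_eq[OF D(1)]) (simp_all only: card_bip)
  then show ?thesis using D(1) by simp
qed

section \<open>Obstructions to extending a tournament\<close>

text \<open>Lets the constructions use any convenient vertex set: the rounds are carried to the
  players by a bijection, and a hypothetical extension is pulled back.\<close>

lemma nonextendable_tournament:
  assumes "finite V" "card V = n" and D: "decomposes k V D r"
    and no: "\<And>F. \<not> cycle_factor k V (complete_edges V - D) F"
  shows "\<exists>Hs. tournament k n Hs \<and> \<not> can_be_extended k n Hs \<and> length Hs = r"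
proof -
  obtain h where h: "bij_betw h V {..<n}"
    using ex_bij_betw_finite_nat[OF assms(1)] assms(2) by (auto simp: atLeast0LessThan)
  have hV: "inj_on h V" "h ` V = {..<n}"
    using h by (auto simp: bij_betw_def)
  have D': "decomposes k {..<n} ((`) h ` D) r"
    using decomposes_image[OF D hV(1)] unfolding hV(2) .
  obtain H where H: "\<And>i. i < r \<Longrightarrow> cycle_factor k {..<n} ((`) h ` D) (H i)"
      "disjoint_family_on (\<lambda>i. \<Union>(H i)) {..<r}" "(`) h ` D = (\<Union>i<r. \<Union>(H i))"
    using D' by (rule decomposesE) blast
  define Hs where "Hs = map H [0..<r]"
  have fact: "cycle_factor k {..<n} (complete_edges {..<n}) (H i)" if "i < r" for i
    by (rule cycle_factor_mono[OF H(1)[OF that] cycle_factor_edges[OF H(1)[OF that]]])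
  have disj: "i = j" if "e \<in> \<Union>(H i) \<and> e \<in> \<Union>(H j)" "i < r" "j < r" for e i j
    using H(2) that unfolding disjoint_family_on_def by blast
  have "tournament k n Hs"
    unfolding tournament_def
  proof (intro conjI ballI allI impI)
    show "cycle_factor k {..<n} (complete_edges {..<n}) G" if "G \<in> set Hs" for G
      using that fact by (auto simp: Hs_def)
    show "i = j" if "i < length Hs" "j < length Hs" "e \<in> \<Union>(Hs ! i) \<and> e \<in> \<Union>(Hs ! j)" for e i j
      using that by (intro disj[of e]) (simp_all add: Hs_def)
  qed
  moreover have "\<not> can_be_extended k n Hs"
  proof
    assume "can_be_extended k n Hs"
    then obtain F where F: "cycle_factor k {..<n} (feasibility_edges n Hs) F"
      by (auto simp: can_be_extended_def)
    have feas: "feasibility_edges n Hs = complete_edges {..<n} - (`) h ` D"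
      unfolding feasibility_edges_def H(3) Hs_def by auto
    let ?\<phi> = "inv_into V h"
    have \<phi>: "inj_on ?\<phi> {..<n}" "?\<phi> ` {..<n} = V"
      using bij_betw_inv_into[OF h] by (auto simp: bij_betw_def)
    have F': "cycle_factor k V ((`) ?\<phi> ` \<Union>F) ((\<lambda>C. (`) ?\<phi> ` C) ` F)" (is "cycle_factor k V ?E ?F")
      using cycle_factor_images[OF F, of "{()}" "\<lambda>_. ?\<phi>"] \<phi> by simp
    have "?\<phi> ` e \<in> complete_edges V - D" if "e \<in> \<Union>F" for e
    proof -
      have e: "e \<in> complete_edges {..<n}" "e \<notin> (`) h ` D"
        using cycle_factorD(4)[OF F] that unfolding feas by auto
      then have "e \<subseteq> {..<n}" "card e = 2" by (auto simp: complete_edges_def)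
      then have "?\<phi> ` e \<subseteq> V" "card (?\<phi> ` e) = 2"
        using \<phi> by (auto simp: card_image inj_on_subset)
      moreover have "h ` ?\<phi> ` e = e"
        using \<open>e \<subseteq> {..<n}\<close> hV(2) by (metis image_inv_into_cancel)
      ultimately show ?thesis
        using e(2) by (auto simp: complete_edges_def) (metis imageI)
    qed
    then have "(`) ?\<phi> ` \<Union>F \<subseteq> complete_edges V - D"
      by blast
    moreover have "\<Union>?F = (`) ?\<phi> ` \<Union>F"
      by blast
    ultimately have "\<Union>?F \<subseteq> complete_edges V - D"
      by simp
    then show False
      using no cycle_factor_mono[OF F'] by blast
  qed
  ultimately show ?thesis
    by (intro exI[of _ Hs]) (simp add: Hs_def)
qed

section \<open>Cycles, cuts and independent sets\<close>

lemma cyclic_exit: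
  fixes Q :: "nat \<Rightarrow> bool"
  assumes "i < k" "j < k" "Q i" "\<not> Q j"
  shows "\<exists>t<k. Q t \<and> \<not> Q (Suc t mod k)"
proof (rule ccontr)
  assume "\<not> ?thesis"
  then have step: "Q (Suc t mod k)" if "t < k" "Q t" for t using that by blast
  have "Q ((i + d) mod k)" for d
  proof (induction d)
    case 0
    then show ?case using assms by simp
  next
    case (Suc d)
    have "Suc ((i + d) mod k) mod k = (i + Suc d) mod k"
      by (simp add: mod_Suc_eq)
    then show ?case
      using step[OF _ Suc] assms(1) by simp
  qed
  \<comment> \<open>From \<open>i\<close>, \<open>j + k - i\<close> steps lead to \<open>j\<close>;
    the summand \<open>k\<close> keeps the subtraction from truncating.\<close>
  from this[of "j + k - i"] show False
    using assms by simp
qed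

text \<open>A cycle that leaves a vertex set also returns to it, and uses two edges of the cut.\<close>

lemma cycle_cut:
  assumes "is_cycle k C"
    and cut: "\<And>d e. d \<in> C \<Longrightarrow> e \<in> C \<Longrightarrow> d \<inter> A \<noteq> {} \<Longrightarrow> \<not> d \<subseteq> A \<Longrightarrow> e \<inter> A \<noteq> {} \<Longrightarrow> \<not> e \<subseteq> A \<Longrightarrow> d = e"
  shows "\<Union>C \<subseteq> A \<or> \<Union>C \<inter> A = {}"
proof (rule ccontr)
  assume neg: "\<not> ?thesis"
  obtain f where f: "k \<ge> 3" "inj_on f {..<k}" "C = cyc k f"
    using assms(1) by (auto simp: is_cycle_iff)
  obtain i j where ij: "i < k" "j < k" "f i \<in> A" "f j \<notin> A"
    using neg unfolding f(3) by auto
  obtain t where t: "t < k" "f t \<in> A" "f (Suc t mod k) \<notin> A"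
    using cyclic_exit[of i k j "\<lambda>t. f t \<in> A"] ij by blast
  obtain t' where t': "t' < k" "f t' \<notin> A" "f (Suc t' mod k) \<in> A"
    using cyclic_exit[of j k i "\<lambda>t. f t \<notin> A"] ij by blast
  have "{f t, f (Suc t mod k)} = {f t', f (Suc t' mod k)}"
    using t t' by (intro cut) (auto simp: f(3) cyc_def)
  then have "t = t'"
    using cyc_edge_inj[OF f(1,2)] t(1) t'(1) by (auto dest: inj_onD)
  then show False using t t' by simp
qed

text \<open>The hypothesis allows at most one edge of \<open>E\<close> across the boundary of
  \<open>A\<close>, so it covers both an empty cut and a bridge. Each cycle is then inside or
  outside \<open>A\<close>, and the inner ones form a factor of \<open>A\<close>.\<close>

lemma cycle_factor_cut:
  assumes F: "cycle_factor k V E F" and "A \<subseteq> V"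
    and cut: "\<And>d e. d \<in> E \<Longrightarrow> e \<in> E \<Longrightarrow> d \<inter> A \<noteq> {} \<Longrightarrow> \<not> d \<subseteq> A \<Longrightarrow> e \<inter> A \<noteq> {} \<Longrightarrow> \<not> e \<subseteq> A \<Longrightarrow> d = e"
  shows "k dvd card A"
proof -
  note FD = cycle_factorD[OF F]
  have cases: "\<Union>C \<subseteq> A \<or> \<Union>C \<inter> A = {}" if "C \<in> F" for C
  proof (rule cycle_cut)
    show "is_cycle k C" by (rule FD(3)[OF that])
    have "C \<subseteq> E" using FD(4) that by blast
    then show "d = e" if "d \<in> C" "e \<in> C" "d \<inter> A \<noteq> {}" "\<not> d \<subseteq> A" "e \<inter> A \<noteq> {}" "\<not> e \<subseteq> A" for d e
      using cut that by blast
  qed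
  define F' where "F' = {C \<in> F. \<Union>C \<subseteq> A}"
  have "cycle_factor k A E F'"
  proof (rule cycle_factorI)
    show "\<Union>(\<Union>F') = A"
    proof
      show "A \<subseteq> \<Union>(\<Union>F')"
      proof
        fix v assume v: "v \<in> A"
        then obtain C where C: "C \<in> F" "v \<in> \<Union>C"
          using FD(6) \<open>A \<subseteq> V\<close> by blast
        then have "C \<in> F'"
          using v cases[of C] unfolding F'_def by blast
        then show "v \<in> \<Union>(\<Union>F')" using C by blast
      qed
    qed (auto simp: F'_def)
  qed (use FD in \<open>auto simp: F'_def\<close>)
  then show ?thesis
    using cycle_factorD(2) by (metis dvd_triv_left)
qed

text \<open>The cyclic successor maps the positions in \<open>A\<close> injectively to positions
  outside \<open>A\<close>, so fewer than half of the \<open>2 * h + 1\<close> positions lie in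
  \<open>A\<close>.\<close>

lemma odd_cycle_independent:
  assumes "is_cycle (2 * h + 1) C" "\<And>e. e \<in> C \<Longrightarrow> \<not> e \<subseteq> A"
  shows "card (\<Union>C \<inter> A) \<le> h"
proof -
  let ?k = "2 * h + 1"
  obtain f where f: "?k \<ge> 3" "inj_on f {..<?k}" "C = cyc ?k f"
    using assms(1) by (auto simp: is_cycle_iff)
  define T where "T = {t. t < ?k \<and> f t \<in> A}"
  have "\<Union>C \<inter> A = f ` T"
    unfolding f(3) Union_cyc T_def by auto
  moreover have "inj_on f T"
    using f(2) by (rule inj_on_subset) (auto simp: T_def)
  ultimately have "card (\<Union>C \<inter> A) = card T"
    by (simp add: card_image)
  have suc: "Suc t mod ?k \<in> {..<?k} - T" if "t \<in> T" for t
  proof -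
    have "{f t, f (Suc t mod ?k)} \<in> C"
      using that unfolding f(3) cyc_def T_def by blast
    then show ?thesis
      using assms(2) that by (fastforce simp: T_def)
  qed
  have "inj_on (\<lambda>t. Suc t mod ?k) T"
  proof (rule inj_onI)
    fix t t' assume t: "t \<in> T" "t' \<in> T" "Suc t mod ?k = Suc t' mod ?k"
    then have "(t + 1) mod ?k = (t' + 1) mod ?k" by simp
    then have "int ?k dvd int t - int t'"
      by (simp only: mod_add_eq_iff_dvd) simp
    then show "t = t'"
      using t by (intro dvd_diff_imp_eq[of ?k]) (auto simp: T_def)
  qed
  then have "card T \<le> card ({..<?k} - T)"
    using suc by (intro card_inj_on_le) auto
  also have "\<dots> = ?k - card T"
    by (subst card_Diff_subset) (auto simp: T_def)
  finally show ?thesis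
    using \<open>card (\<Union>C \<inter> A) = card T\<close> by linarith
qed

lemma cycle_factor_independent:
  assumes F: "cycle_factor (2 * h + 1) V E F" and "A \<subseteq> V" "\<And>e. e \<in> E \<Longrightarrow> \<not> e \<subseteq> A"
  shows "card A \<le> h * card F"
proof -
  note FD = cycle_factorD[OF F]
  have "A = (\<Union>C\<in>F. \<Union>C \<inter> A)"
    using FD(6) \<open>A \<subseteq> V\<close> by blast
  then have "card A \<le> (\<Sum>C\<in>F. card (\<Union>C \<inter> A))"
    using card_UN_le[OF FD(1), of "\<lambda>C. \<Union>C \<inter> A"] by simp
  also have "\<dots> \<le> (\<Sum>C\<in>F. h)"
    using FD(3,4) assms(3) by (intro sum_mono odd_cycle_independent) blast+
  finally show ?thesis by (simp add: mult.commute)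
qed

section \<open>The two rounds covering the matching\<close>

text \<open>A Hamiltonian cycle of the prism over \<open>{..<l}\<close>, \<open>l\<close> odd, using all rungs except the one at \<open>0\<close>.
  With \<open>T\<close> and \<open>F\<close> for the sides it runs through
  \<open>T0, T1, F1, F2, T2, T3, F3, \<dots>, F(l - 2), F0, F(l - 1), T(l - 1)\<close>.\<close>

definition prism_pos :: "nat \<Rightarrow> nat \<Rightarrow> bool \<times> nat" where
  "prism_pos l t =
     (if t + 4 \<le> 2 * l then (t mod 4 < 2, (t + 1) div 2)
      else if t + 3 = 2 * l then (False, 0)
      else (t + 1 = 2 * l, l - 1))"

text \<open>\<open>g\<close> puts the prism on other labels; the choice of \<open>g 0\<close>
  decides which rung is left out.\<close>

definition prism :: "nat \<Rightarrow> (nat \<Rightarrow> nat) \<Rightarrow> (bool \<times> nat) set set" where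
  "prism l g = cyc (2 * l) (apsnd g \<circ> prism_pos l)"

text \<open>The zigzag visits the sides in the pattern T, T, F, F: a rung follows each odd position,
  an edge inside a side each even one.\<close>

lemma odd_imp_mod_4_flip: "odd t \<Longrightarrow> (Suc t mod 4 < 2) \<noteq> (t mod 4 < (2 :: nat))"
  by presburger

lemma even_imp_mod_4_eq: "even t \<Longrightarrow> (Suc t mod 4 < 2) = (t mod 4 < (2 :: nat))"
  by presburger

lemma bij_betw_prism_pos:
  assumes "odd l" "l \<ge> 3"
  shows "bij_betw (prism_pos l) {..<2 * l} (bip l)"
proof -
  have "inj_on (prism_pos l) {..<2 * l}"
  proof (rule inj_onI)
    fix t t' assume t: "t \<in> {..<2 * l}" "t' \<in> {..<2 * l}" "prism_pos l t = prism_pos l t'"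
    have mod4: "t = t'" if "(t mod 4 < 2) = (t' mod 4 < 2)" "(t + 1) div 2 = (t' + 1) div 2"
    proof -
      have "t = t' \<or> odd t \<and> t' = Suc t \<or> odd t' \<and> t = Suc t'"
        using that(2) by presburger
      then show ?thesis using odd_imp_mod_4_flip that(1) by metis
    qed
    \<comment> \<open>The zigzag stays below label \<open>l - 1\<close> and meets label 0 only on
      the True side, so the last three positions are new.\<close>
    have small: "(t + 1) div 2 < l - 1 \<and> ((t + 1) div 2 = 0 \<longrightarrow> t mod 4 < 2)" if "t + 4 \<le> 2 * l" for t
    proof -
      have "t = 0" if "(t + 1) div 2 = 0" using that by presburger
      then show ?thesis using that by auto
    qed
    show "t = t'"
      using t mod4 small[of t] small[of t'] assms(2) unfolding prism_pos_def
      by (auto split: if_splits)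
  qed
  moreover have "prism_pos l ` {..<2 * l} \<subseteq> bip l"
    using assms by (auto simp: prism_pos_def bip_def)
  ultimately show ?thesis
    by (metis bij_betw_def card_bip card_image card_lessThan card_subset_eq finite_bip)
qed

lemma prism_pos_edge:
  assumes "odd l" "l \<ge> 3" "e \<in> cyc (2 * l) (prism_pos l)"
  shows "(\<exists>i. 1 \<le> i \<and> i < l \<and> e = bip_edge i i) \<or>
    (\<exists>s i j. i < l \<and> j < l \<and> i \<noteq> j \<and> e = {(s, i), (s, j)})"
proof -
  obtain t where t: "t < 2 * l" "e = {prism_pos l t, prism_pos l (Suc t mod (2 * l))}"
    using assms(3) by (auto simp: cyc_def)
  consider "t + 4 < 2 * l" "odd t" | "t + 4 < 2 * l" "even t" | "t + 4 = 2 * l" | "t + 3 = 2 * l"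
    | "t + 2 = 2 * l" | "t + 1 = 2 * l"
    using t(1) by linarith
  then show ?thesis
  proof cases
    case 1
    then obtain a where a: "t = 2 * a + 1" by (blast elim: oddE)
    have "(Suc t mod 4 < 2) \<noteq> (t mod 4 < 2)" using 1(2) by (rule odd_imp_mod_4_flip)
    then have "e = bip_edge (a + 1) (a + 1)"
      using t 1 a by (cases "t mod 4 < 2") (auto simp: prism_pos_def bip_edge_def)
    then show ?thesis using 1 a by auto
  next
    case 2
    then obtain a where a: "t = 2 * a" by blast
    have "(Suc t mod 4 < 2) = (t mod 4 < 2)"
      using 2(2) by (rule even_imp_mod_4_eq)
    then have "e = {(t mod 4 < 2, a), (t mod 4 < 2, a + 1)}"
      using t 2 a by (auto simp: prism_pos_def)
    moreover have "a + 1 < l" using 2 a by simp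
    ultimately show ?thesis
      by (intro disjI2 exI[of _ "t mod 4 < 2"] exI[of _ a] exI[of _ "a + 1"]) simp
  next
    case 3
    \<comment> \<open>Oddness of \<open>l\<close> enters here: \<open>2 * l - 4\<close> is 2 modulo
      4, so the zigzag ends on the False side and the step to \<open>(False, 0)\<close> stays inside
      that side.\<close>
    have "\<not> t mod 4 < 2" 
    proof -
      obtain a where "l = 2 * a + 1" using assms(1) by (rule oddE)
      then have "\<exists>b. t = 4 * b + 2"
        using 3 assms(2) by (intro exI[of _ "a - 1"]) linarith
      then show ?thesis by presburger
    qed
    moreover have "(t + 1) div 2 = l - 2" using 3 by linarith
    ultimately have "e = {(False, l - 2), (False, 0)}"
      using t 3 by (auto simp: prism_pos_def)
    then show ?thesis
      using assms(2) by (intro disjI2 exI[of _ False] exI[of _ "l - 2"] exI[of _ 0]) simp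
  next
    case 4
    then have "e = {(False, 0), (False, l - 1)}"
      using t by (auto simp: prism_pos_def)
    then show ?thesis
      using assms(2) by (intro disjI2 exI[of _ False] exI[of _ 0] exI[of _ "l - 1"]) simp
  next
    case 5
    then have "e = bip_edge (l - 1) (l - 1)"
      using t by (auto simp: prism_pos_def bip_edge_def)
    then show ?thesis using assms(2) by (intro disjI1 exI[of _ "l - 1"]) simp
  next
    case 6
    then have "e = {(True, l - 1), (True, 0)}"
      using t assms(2) by (auto simp: prism_pos_def)
    then show ?thesis
      using assms(2) by (intro disjI2 exI[of _ True] exI[of _ "l - 1"] exI[of _ 0]) simp
  qed
qed

lemma prism_pos_rung:
  assumes "odd l" "l \<ge> 3" "1 \<le> i" "i < l"
  shows "bip_edge i i \<in> cyc (2 * l) (prism_pos l)"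
proof -
  \<comment> \<open>Rung \<open>i\<close> lies between positions \<open>2 * i - 1\<close> and
    \<open>2 * i\<close>; the last rung comes one position later because of the detour to
    \<open>(False, 0)\<close>.\<close>
  define t where "t = (if i = l - 1 then 2 * l - 2 else 2 * i - 1)"
  have t: "t < 2 * l" "Suc t mod (2 * l) = Suc t"
    using assms by (auto simp: t_def)
  have "{prism_pos l t, prism_pos l (Suc t)} = bip_edge i i"
  proof (cases "i = l - 1")
    case True
    then show ?thesis
      using assms by (auto simp: t_def prism_pos_def bip_edge_def)
  next
    case False
    then have "t + 5 \<le> 2 * l" "(t + 1) div 2 = i" "(Suc t + 1) div 2 = i" "odd t"
      using assms by (auto simp: t_def)
    moreover have "(Suc t mod 4 < 2) \<noteq> (t mod 4 < 2)" using \<open>odd t\<close> by (rule odd_imp_mod_4_flip)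
    ultimately show ?thesis
      by (cases "t mod 4 < 2") (auto simp: prism_pos_def bip_edge_def)
  qed
  then show ?thesis
    using t unfolding cyc_def by force
qed

lemma prism:
  assumes "odd l" "l \<ge> 3" "inj_on g {..<l}"
  shows "is_cycle (2 * l) (prism l g)" "\<Union>(prism l g) = UNIV \<times> g ` {..<l}"
    and "\<And>i. 1 \<le> i \<Longrightarrow> i < l \<Longrightarrow> bip_edge (g i) (g i) \<in> prism l g"
    and "\<And>e. e \<in> prism l g \<Longrightarrow> (\<exists>i. 1 \<le> i \<and> i < l \<and> e = bip_edge (g i) (g i)) \<or>
      (\<exists>s i j. i < l \<and> j < l \<and> i \<noteq> j \<and> e = {(s, g i), (s, g j)})"
proof -
  have bij: "inj_on (prism_pos l) {..<2 * l}" "prism_pos l ` {..<2 * l} = bip l"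
    using bij_betw_prism_pos[OF assms(1,2)] by (auto simp: bij_betw_def)
  have "inj_on (apsnd g) (bip l)"
    using assms(3) by (auto simp: bip_def inj_on_def)
  then have "inj_on (apsnd g \<circ> prism_pos l) {..<2 * l}"
    using bij by (intro comp_inj_on) auto
  then show "is_cycle (2 * l) (prism l g)"
    using assms(2) by (auto simp: prism_def intro: is_cycleI)
  show "\<Union>(prism l g) = UNIV \<times> g ` {..<l}"
    unfolding prism_def Union_cyc image_comp[symmetric] bij(2) by (force simp: bip_def)
  have img: "prism l g = (`) (apsnd g) ` cyc (2 * l) (prism_pos l)"
    by (simp add: prism_def image_cyc)
  have rung: "apsnd g ` bip_edge i i = bip_edge (g i) (g i)" for i
    by (simp add: bip_edge_def)
  show "bip_edge (g i) (g i) \<in> prism l g" if "1 \<le> i" "i < l" for i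
    using prism_pos_rung[OF assms(1,2) that] unfolding img rung[symmetric] by (rule imageI)
  show "(\<exists>i. 1 \<le> i \<and> i < l \<and> e = bip_edge (g i) (g i)) \<or>
      (\<exists>s i j. i < l \<and> j < l \<and> i \<noteq> j \<and> e = {(s, g i), (s, g j)})" if e: "e \<in> prism l g" for e
  proof -
    obtain e' where e': "e' \<in> cyc (2 * l) (prism_pos l)" "e = apsnd g ` e'"
      using e unfolding img by blast
    from prism_pos_edge[OF assms(1,2) e'(1)] show ?thesis
    proof (elim disjE exE conjE)
      fix i assume "1 \<le> i" "i < l" "e' = bip_edge i i"
      then show ?thesis using e'(2) rung by blast
    next
      fix s i j assume "i < l" "j < l" "i \<noteq> j" "e' = {(s, i), (s, j)}"
      moreover from this have "e = {(s, g i), (s, g j)}" using e'(2) by simp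
      ultimately show ?thesis by blast
    qed
  qed
qed

text \<open>One prism for each residue class modulo \<open>P\<close>. Its label 0 is the smallest
  member of the class, so the missing rungs are exactly those below \<open>P\<close>.\<close>

lemma rungs_same_residue:
  assumes "odd l" "l \<ge> 3" "P > 0"
  obtains D where "decomposes (2 * l) (bip (l * P)) D 1"
    "\<And>x. P \<le> x \<Longrightarrow> x < l * P \<Longrightarrow> bip_edge x x \<in> D"
    "\<And>e. e \<in> D \<Longrightarrow> (\<exists>x\<ge>P. e = bip_edge x x) \<or>
      (\<exists>s x y. x mod P = y mod P \<and> e = {(s, x), (s, y)})"
proof -
  define g where "g y i = i * P + y" for y i :: nat
  define F where "F = (\<lambda>y. prism l (g y)) ` {..<P}"
  have inj: "inj_on (g y) {..<l}" for y
    using assms(3) by (auto simp: g_def inj_on_def)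
  note pr = prism[OF assms(1,2) inj]
  have gmod: "g y i mod P = y" if "y < P" for y i
    using that by (simp add: g_def)
  have "cycle_factor (2 * l) (bip (l * P)) (\<Union>F) F"
  proof (rule cycle_factorI)
    show "is_cycle (2 * l) C" if "C \<in> F" for C
      using that pr(1) by (auto simp: F_def)
    have "\<Union>(\<Union>F) = (\<Union>y\<in>{..<P}. \<Union>(prism l (g y)))"
      by (auto simp: F_def)
    also have "\<dots> = UNIV \<times> (\<Union>y\<in>{..<P}. g y ` {..<l})"
      unfolding pr(2) by auto
    also have "(\<Union>y\<in>{..<P}. g y ` {..<l}) = (\<Union>i\<in>{..<l}. (\<lambda>x. i * P + x) ` {..<P})"
      unfolding g_def by blast
    finally show "\<Union>(\<Union>F) = bip (l * P)"
      unfolding UN_block by (simp add: bip_def)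
    show "\<Union>C \<inter> \<Union>D = {}" if CD: "C \<in> F" "D \<in> F" "C \<noteq> D" for C D
    proof -
      obtain y z where yz: "y < P" "z < P" "C = prism l (g y)" "D = prism l (g z)"
        using CD by (auto simp: F_def)
      then have "y \<noteq> z" using CD by blast
      then have "g y i \<noteq> g z j" for i j
        using gmod[of y i] gmod[of z j] yz by auto
      then show ?thesis
        unfolding yz(3,4) pr(2) by blast
    qed
  qed (simp_all add: F_def)
  then have "decomposes (2 * l) (bip (l * P)) (\<Union>F) 1"
    by (rule decomposes_1)
  moreover have "bip_edge x x \<in> \<Union>F" if "P \<le> x" "x < l * P" for x
  proof -
    have "x = g (x mod P) (x div P)" by (simp add: g_def)
    moreover have "1 \<le> x div P" "x div P < l" "x mod P < P"
      using that assms(3) by (auto simp: less_mult_imp_div_less div_greater_zero_iff Suc_le_eq)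
    ultimately have "bip_edge x x \<in> prism l (g (x mod P))"
      using pr(3)[of "x div P" "x mod P"] by simp
    then show ?thesis
      using \<open>x mod P < P\<close> by (auto simp: F_def)
  qed
  moreover have "(\<exists>x\<ge>P. e = bip_edge x x) \<or> (\<exists>s x y. x mod P = y mod P \<and> e = {(s, x), (s, y)})"
    if e: "e \<in> \<Union>F" for e
  proof -
    obtain y where y: "y < P" "e \<in> prism l (g y)"
      using e by (auto simp: F_def)
    from pr(4)[OF y(2)] show ?thesis
    proof (elim disjE exE conjE)
      fix i assume i: "1 \<le> i" "e = bip_edge (g y i) (g y i)"
      have "1 * P \<le> i * P" using i by (intro mult_right_mono) auto
      then have "P \<le> g y i" unfolding g_def by linarith
      then show ?thesis using i by blast
    next
      fix s i j assume "e = {(s, g y i), (s, g y j)}"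
      then show ?thesis using gmod[OF y(1)] by metis
    qed
  qed
  ultimately show ?thesis using that by blast
qed

text \<open>The rungs below \<open>P - 1\<close> are cut into \<open>c\<close> runs of
  \<open>l - 1\<close>; each run, with one far label for the missing rung, carries a prism. The rest
  is covered by cycles inside the sides, for which its \<open>l * (P - c)\<close> labels must be a
  multiple of \<open>2 * l\<close>: hence the parity condition.\<close>

lemma rungs_distinct_residues:
  assumes l: "odd l" "l \<ge> 3" and P: "P = c * (l - 1) + 1" "even (P - c)" "2 * l \<le> P"
  obtains D where "decomposes (2 * l) (bip (l * P)) D 1"
    "\<And>x. x < P - 1 \<Longrightarrow> bip_edge x x \<in> D"
    "\<And>e. e \<in> D \<Longrightarrow> (\<exists>x<P - 1. e = bip_edge x x) \<or>
      (\<exists>s x y. x mod P \<noteq> y mod P \<and> e = {(s, x), (s, y)})"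
proof -
  define q where "q = l - 1"
  have q: "l = q + 1" "q \<ge> 2" using l by (auto simp: q_def)
  have Pq: "P = c * q + 1" using P(1) by (simp add: q_def)
  have "c * 1 \<le> c * q" using q(2) by (intro mult_left_mono) auto
  then have cP: "c \<le> P" using Pq by linarith
  obtain d where d: "P - c = 2 * d" using P(2) by blast
  \<comment> \<open>The top \<open>c\<close> labels \<open>a, ..., l * P - 1\<close> take the
    missing rungs, one for each prism.\<close>
  define a where "a = l * P - c"
  have a_eq: "a = P - 1 + d * (2 * l)"
  proof -
    have "l * (P - c) = d * (2 * l)" using d by simp
    moreover have "l * (P - c) + l * c = l * P"
      using cP by (simp flip: distrib_left)
    moreover have "l * c = (P - 1) + c" using Pq q(1) by (simp add: algebra_simps)
    ultimately show ?thesis unfolding a_def by linarith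
  qed
  have a_c: "a + c = l * P"
  proof -
    have "c \<le> 1 * P" using cP by simp
    also have "\<dots> \<le> l * P" using l(2) by (intro mult_right_mono) auto
    finally show ?thesis by (simp add: a_def)
  qed
  have a_mod: "(a + t) mod P = P - c + t" if "t < c" for t
  proof -
    have "a = q * P + (P - c)"
      using a_c cP q(1) by (simp add: algebra_simps)
    then have "a + t = q * P + (P - c + t)" by simp
    moreover have "P - c + t < P" using that cP by linarith
    ultimately show ?thesis by (simp only: mod_mult_self3 mod_less)
  qed
  define g where "g t i = (if i = 0 then a + t else t * q + (i - 1))" for t i
  \<comment> \<open>The far label of prism \<open>t\<close> has residue \<open>P - c + t\<close>,
    above all its other labels, so the \<open>l\<close> labels are pairwise incongruent modulo
    \<open>P\<close>.\<close>
  have g_small: "g t i < P - 1 \<and> g t i < P - c + t" if "t < c" "1 \<le> i" "i < l" for t i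
  proof -
    obtain w where w: "c = t + 1 + w"
      using \<open>t < c\<close> by (metis Suc_eq_plus1 Suc_leI le_Suc_ex)
    have "c * q = t * q + q + w * q" unfolding w by (simp add: algebra_simps)
    moreover have "w * 1 \<le> w * q" using q(2) by (intro mult_left_mono) auto
    moreover have "g t i \<le> t * q + (q - 1)" using that q by (auto simp: g_def)
    ultimately show ?thesis
      using Pq w q(2) by linarith
  qed
  have g_mod: "g t i mod P \<noteq> g t j mod P" if "t < c" "i < l" "j < l" "i \<noteq> j" for t i j
  proof -
    have 1: "g t i mod P = g t i \<and> g t i < P - c + t" if "1 \<le> i" "i < l" for i
      using g_small[OF \<open>t < c\<close> that] by auto
    have 0: "g t 0 mod P = P - c + t" using a_mod[OF \<open>t < c\<close>] by (simp add: g_def)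
    consider "i = 0" "1 \<le> j" | "1 \<le> i" "j = 0" | "1 \<le> i" "1 \<le> j"
      using \<open>i \<noteq> j\<close> by linarith
    then show ?thesis
    proof cases
      case 3
      then have "g t i \<noteq> g t j" using \<open>i \<noteq> j\<close> by (auto simp: g_def)
      then show ?thesis using 1[of i] 1[of j] 3 that by simp
    qed (use 0 1[of i] 1[of j] that in auto)
  qed
  have inj: "inj_on (g t) {..<l}" if "t < c" for t
    using g_mod[OF that] by (metis inj_onI lessThan_iff)
  note pr = prism[OF l inj]
  have g_img: "g t ` {..<l} = insert (a + t) ((\<lambda>x. t * q + x) ` {..<q})" for t
  proof -
    have "{..<l} = insert 0 (Suc ` {..<q})"
      using q(1) by (simp add: lessThan_Suc_eq_insert_0)
    then have "g t ` {..<l} = insert (g t 0) ((\<lambda>x. g t (Suc x)) ` {..<q})"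
      by (simp only: image_insert image_image)
    then show ?thesis by (simp add: g_def)
  qed
  define G where "G = (\<lambda>t. prism l (g t)) ` {..<c}"
  have G: "cycle_factor (2 * l) (UNIV \<times> ({..<P - 1} \<union> {a..<l * P})) (\<Union>G) G"
  proof (rule cycle_factorI)
    show "is_cycle (2 * l) C" if "C \<in> G" for C
      using that pr(1) by (auto simp: G_def)
    have "\<Union>(\<Union>G) = (\<Union>t\<in>{..<c}. \<Union>(prism l (g t)))"
      by (auto simp: G_def)
    also have "\<dots> = (\<Union>t\<in>{..<c}. UNIV \<times> g t ` {..<l})"
      using pr(2) by (intro SUP_cong) auto
    also have "\<dots> = UNIV \<times> ((\<Union>t\<in>{..<c}. (\<lambda>x. t * q + x) ` {..<q}) \<union> (\<lambda>t. a + t) ` {..<c})"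
      unfolding g_img by auto
    also have "(\<lambda>t. a + t) ` {..<c} = {a..<l * P}"
      unfolding a_c[symmetric] lessThan_atLeast0 by (simp add: add.commute)
    finally show "\<Union>(\<Union>G) = UNIV \<times> ({..<P - 1} \<union> {a..<l * P})"
      unfolding UN_block using Pq by simp
    show "\<Union>C \<inter> \<Union>D = {}" if CD: "C \<in> G" "D \<in> G" "C \<noteq> D" for C D
    proof -
      obtain t u where tu: "t < c" "u < c" "C = prism l (g t)" "D = prism l (g u)"
        using CD by (auto simp: G_def)
      then have "t \<noteq> u" using CD by blast
      have big: "y < a" if "y \<in> (\<lambda>x. t * q + x) ` {..<q}" "t < c" for y t
      proof -
        obtain x where x: "x < q" "y = t * q + x" using \<open>y \<in> _\<close> by blast
        then have "y = g t (x + 1)" by (simp add: g_def)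
        then show ?thesis using g_small[OF \<open>t < c\<close>, of "x + 1"] x q(1) a_eq by linarith
      qed
      have "g t ` {..<l} \<inter> g u ` {..<l} = {}"
        unfolding g_img using disjoint_blocks[OF \<open>t \<noteq> u\<close>, of q] big[of "a + t" u] big[of "a + u" t]
          tu \<open>t \<noteq> u\<close> by auto
      then show ?thesis
        unfolding tu(3,4) pr(2)[OF tu(1)] pr(2)[OF tu(2)] by blast
    qed
  qed (simp_all add: G_def)
  \<comment> \<open>On each side the labels from \<open>P - 1\<close> to \<open>a - 1\<close> form
    \<open>d\<close> runs of \<open>2 * l\<close> consecutive labels, each closed up to a
    cycle.\<close>
  define f where "f p u = (fst p, P - 1 + (snd p * (2 * l) + u))" for p :: "bool \<times> nat" and u
  define B where "B = (\<lambda>p. cyc (2 * l) (f p)) ` (UNIV \<times> {..<d})"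
  have f_inj: "inj_on (f p) {..<2 * l}" for p
    by (auto simp: f_def inj_on_def)
  have f_img: "f p ` {..<2 * l} = {fst p} \<times> (\<lambda>x. P - 1 + x) ` (\<lambda>x. snd p * (2 * l) + x) ` {..<2 * l}" for p
    by (auto simp: f_def)
  have BF: "cycle_factor (2 * l) (UNIV \<times> {P - 1..<a}) (\<Union>B) B"
  proof (rule cycle_factorI)
    show "is_cycle (2 * l) C" if "C \<in> B" for C
      using that l(2) by (auto simp: B_def intro!: is_cycleI f_inj)
    have "\<Union>(\<Union>B) = (\<Union>p\<in>UNIV \<times> {..<d}. \<Union>(cyc (2 * l) (f p)))"
      unfolding B_def by blast
    also have "\<dots> = (\<Union>p\<in>UNIV \<times> {..<d}. f p ` {..<2 * l})"
      by simp
    also have "\<dots> = UNIV \<times> (\<lambda>x. P - 1 + x) ` (\<Union>b\<in>{..<d}. (\<lambda>x. b * (2 * l) + x) ` {..<2 * l})"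
      unfolding f_img by fastforce
    also have "(\<lambda>x. P - 1 + x) ` (\<Union>b\<in>{..<d}. (\<lambda>x. b * (2 * l) + x) ` {..<2 * l}) = {P - 1..<a}"
      unfolding UN_block a_eq unfolding lessThan_atLeast0 by (simp add: add.commute)
    finally show "\<Union>(\<Union>B) = UNIV \<times> {P - 1..<a}" .
    show "\<Union>C \<inter> \<Union>D = {}" if CD: "C \<in> B" "D \<in> B" "C \<noteq> D" for C D
    proof -
      obtain p p' where p: "C = cyc (2 * l) (f p)" "D = cyc (2 * l) (f p')"
        using CD(1,2) unfolding B_def by blast
      have "p \<noteq> p'"
        using CD(3) p by blast
      have "f p u \<noteq> f p' u'" if "u < 2 * l" "u' < 2 * l" for u u'
      proof
        assume "f p u = f p' u'"
        then have eq: "fst p = fst p'" "snd p * (2 * l) + u = snd p' * (2 * l) + u'"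
          by (simp_all add: f_def)
        have "snd p = snd p'"
          using disjoint_blocks[of "snd p" "snd p'" "2 * l"] eq(2) that by blast
        then show False
          using \<open>p \<noteq> p'\<close> eq(1) by (simp add: prod_eq_iff)
      qed
      then show ?thesis
        unfolding p Union_cyc by blast
    qed
  qed (simp_all add: B_def)
  have "cycle_factor (2 * l) (UNIV \<times> ({..<P - 1} \<union> {a..<l * P}) \<union> UNIV \<times> {P - 1..<a})
      (\<Union>G \<union> \<Union>B) (G \<union> B)"
    using G BF a_eq by (intro cycle_factor_Un) auto
  moreover have "UNIV \<times> ({..<P - 1} \<union> {a..<l * P}) \<union> UNIV \<times> {P - 1..<a} = bip (l * P)"
    using a_eq a_c by (auto simp: bip_def)
  ultimately have "decomposes (2 * l) (bip (l * P)) (\<Union>(G \<union> B)) 1"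
    by (metis decomposes_1)
  moreover have "bip_edge x x \<in> \<Union>(G \<union> B)" if "x < P - 1" for x
  proof -
    have "x = g (x div q) (Suc (x mod q))" by (simp add: g_def)
    moreover have "x div q < c"
      using that Pq by (intro less_mult_imp_div_less) simp
    moreover have "Suc (x mod q) < l"
      using q by simp
    ultimately have "bip_edge x x \<in> prism l (g (x div q))"
      using pr(3)[of "x div q" "Suc (x mod q)"] by simp
    then show ?thesis
      using \<open>x div q < c\<close> by (auto simp: G_def)
  qed
  moreover have "(\<exists>x<P - 1. e = bip_edge x x) \<or> (\<exists>s x y. x mod P \<noteq> y mod P \<and> e = {(s, x), (s, y)})"
    if e: "e \<in> \<Union>(G \<union> B)" for e
  proof -
    consider t where "t < c" "e \<in> prism l (g t)" | p where "e \<in> cyc (2 * l) (f p)"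
      using e by (auto simp: G_def B_def)
    then show ?thesis
    proof cases
      case 1
      from pr(4)[OF 1] show ?thesis
      proof (elim disjE exE conjE)
        fix i assume "1 \<le> i" "i < l" "e = bip_edge (g t i) (g t i)"
        then show ?thesis using g_small[OF 1(1)] by blast
      next
        fix s i j assume "i < l" "j < l" "i \<noteq> j" "e = {(s, g t i), (s, g t j)}"
        then show ?thesis using g_mod[OF 1(1)] by blast
      qed
    next
      case 2
      then obtain u where u: "u < 2 * l" "e = {f p u, f p (Suc u mod (2 * l))}"
        by (auto simp: cyc_def)
      define v where "v = Suc u mod (2 * l)"
      have v: "v < 2 * l" "v \<noteq> u"
        using u(1) l(2) by (auto simp: v_def mod_Suc)
      define N where "N = P - 1 + snd p * (2 * l)"
      \<comment> \<open>Labels in one run differ by less than \<open>2 * l\<close>, hence by less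
        than \<open>P\<close>.\<close>
      have "(u + N) mod P \<noteq> (v + N) mod P"
      proof
        assume "(u + N) mod P = (v + N) mod P"
        then have "int P dvd int u - int v"
          by (simp only: mod_add_eq_iff_dvd) simp
        then show False
          using v u(1) P(3) dvd_diff_imp_eq[of P u v] by simp
      qed
      moreover have "e = {(fst p, u + N), (fst p, v + N)}"
        using u(2) by (simp add: f_def N_def v_def add_ac)
      ultimately show ?thesis by blast
    qed
  qed
  ultimately show ?thesis using that by blast
qed

section \<open>The tournaments\<close>

lemma crossing_edge_bip:
  assumes "e \<in> complete_edges (bip m)" "e \<inter> {False} \<times> {..<m} \<noteq> {}" "\<not> e \<subseteq> {False} \<times> {..<m}"
  shows "\<exists>x<m. \<exists>y<m. e = bip_edge x y"
proof -
  obtain u v where uv: "e = {u, v}" "u \<in> {False} \<times> {..<m}" "v \<notin> {False} \<times> {..<m}"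
    using assms by (auto simp: complete_edges_def card_2_iff)
  moreover have "e \<subseteq> UNIV \<times> {..<m}"
    using assms(1) by (auto simp: complete_edges_def bip_def)
  ultimately show ?thesis
    by (cases u; cases v) (auto simp: bip_edge_def)
qed

lemma nonextendable_doubly_even:
  assumes "even l" "l \<ge> 2" "odd p"
  shows "\<exists>Hs. tournament (2 * l) (2 * (l * p)) Hs \<and> \<not> can_be_extended (2 * l) (2 * (l * p)) Hs \<and>
    length Hs = l * p div 2"
proof (rule nonextendable_tournament[OF finite_bip card_bip decomposes_complete_bipartite[OF assms]])
  let ?m = "l * p"
  let ?D = "{bip_edge x y | x y. x < ?m \<and> y < ?m}"
  fix F
  show "\<not> cycle_factor (2 * l) (bip ?m) (complete_edges (bip ?m) - ?D) F"
  proof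
    assume "cycle_factor (2 * l) (bip ?m) (complete_edges (bip ?m) - ?D) F"
    then have "2 * l dvd card ({False} \<times> {..<?m})"
    proof (rule cycle_factor_cut)
      show "{False} \<times> {..<?m} \<subseteq> bip ?m" by (auto simp: bip_def)
      fix d e assume "d \<in> complete_edges (bip ?m) - ?D" "d \<inter> {False} \<times> {..<?m} \<noteq> {}"
        "\<not> d \<subseteq> {False} \<times> {..<?m}"
      then show "d = e" using crossing_edge_bip[of d ?m] by blast
    qed
    then have "l * 2 dvd l * p"
      by (simp add: card_cartesian_product mult.commute)
    then show False
      using assms by (simp add: dvd_mult_cancel_left)
  qed
qed

text \<open>\<open>D0\<close> takes the crossing edges off the matching, \<open>D1\<close> the rungs
  from \<open>P\<close> on, \<open>D2\<close> those below \<open>P - 1\<close>. The rung at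
  \<open>P - 1\<close> remains as a bridge between halves of odd size. Oddness of \<open>c\<close>
  makes \<open>P - c\<close> even, as the second extra round requires.\<close>

lemma nonextendable_singly_even:
  assumes l: "odd l" "l \<ge> 3" and P: "P = l ^ j" "P = c * (l - 1) + 1" "odd c" "2 * l \<le> P"
  shows "\<exists>Hs. tournament (2 * l) (2 * (l * P)) Hs \<and> \<not> can_be_extended (2 * l) (2 * (l * P)) Hs \<and>
    length Hs = (l * P - 1) div 2 + 2"
proof -
  let ?m = "l * P"
  have P0: "P > 0" using P(2) by simp
  have "even (P - c)" using l(1) P(1,3) by simp
  define D0 where "D0 = {bip_edge x y | x y. x < ?m \<and> y < ?m \<and> x \<noteq> y}"
  have D0: "decomposes (2 * l) (bip ?m) D0 ((?m - 1) div 2)"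
    using decomposes_bipartite_minus_matching[of l "Suc j"] l P(1) by (simp add: D0_def)
  obtain D1 where D1: "decomposes (2 * l) (bip ?m) D1 1"
    "\<And>x. P \<le> x \<Longrightarrow> x < ?m \<Longrightarrow> bip_edge x x \<in> D1"
    "\<And>e. e \<in> D1 \<Longrightarrow> (\<exists>x\<ge>P. e = bip_edge x x) \<or>
      (\<exists>s x y. x mod P = y mod P \<and> e = {(s, x), (s, y)})"
    using rungs_same_residue[OF l P0] by blast
  obtain D2 where D2: "decomposes (2 * l) (bip ?m) D2 1"
    "\<And>x. x < P - 1 \<Longrightarrow> bip_edge x x \<in> D2"
    "\<And>e. e \<in> D2 \<Longrightarrow> (\<exists>x<P - 1. e = bip_edge x x) \<or>
      (\<exists>s x y. x mod P \<noteq> y mod P \<and> e = {(s, x), (s, y)})"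
    using rungs_distinct_residues[OF l P(2) \<open>even (P - c)\<close> P(4)] by blast
  have side: "bip_edge x y \<noteq> {(s, u), (s, v)}" for x y s u v
    by (auto simp: bip_edge_def doubleton_eq_iff)
  have "D0 \<inter> D1 = {}"
    using D1(3) side by (fastforce simp: D0_def)
  moreover have "(D0 \<union> D1) \<inter> D2 = {}"
  proof -
    have "e \<notin> D0" if "e \<in> D2" for e
      using D2(3)[OF that] side by (auto simp: D0_def)
    moreover have "e \<notin> D1" if "e \<in> D2" for e
    proof
      assume "e \<in> D1"
      note e1 = D1(3)[OF \<open>e \<in> D1\<close>]
      from D2(3)[OF that] show False
      proof (elim disjE exE conjE)
        fix x assume x: "x < P - 1" "e = bip_edge x x"
        from e1 show False
          unfolding x(2) using x(1) side by auto
      next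
        fix s x y assume x: "x mod P \<noteq> y mod P" "e = {(s, x), (s, y)}"
        from e1 show False
        proof (elim disjE exE conjE)
          fix u assume "e = bip_edge u u"
          then show False using x(2) side by metis
        next
          fix s' u v assume u: "u mod P = v mod P" "e = {(s', u), (s', v)}"
          have "u = x \<and> v = y \<or> u = y \<and> v = x"
            using u(2) unfolding x(2) by (auto simp: doubleton_eq_iff)
          then show False using u(1) x(1) by auto
        qed
      qed
    qed
    ultimately show ?thesis by blast
  qed
  ultimately have D: "decomposes (2 * l) (bip ?m) (D0 \<union> D1 \<union> D2) ((?m - 1) div 2 + 1 + 1)"
    by (intro decomposes_add D0 D1(1) D2(1))
  have bridge: "e = bip_edge (P - 1) (P - 1)"
    if e: "e \<in> complete_edges (bip ?m) - (D0 \<union> D1 \<union> D2)" "e \<inter> {False} \<times> {..<?m} \<noteq> {}"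
      "\<not> e \<subseteq> {False} \<times> {..<?m}" for e
  proof -
    obtain x y where xy: "x < ?m" "y < ?m" "e = bip_edge x y"
      using crossing_edge_bip[of e ?m] e by blast
    have "x = y" using xy e(1) by (auto simp: D0_def)
    moreover have "\<not> P \<le> x" "\<not> x < P - 1"
      using D1(2) D2(2) xy e(1) \<open>x = y\<close> by auto
    ultimately show ?thesis using xy by (metis Suc_diff_1 P0 less_Suc_eq not_le)
  qed
  have "\<not> cycle_factor (2 * l) (bip ?m) (complete_edges (bip ?m) - (D0 \<union> D1 \<union> D2)) F" for F
  proof
    assume "cycle_factor (2 * l) (bip ?m) (complete_edges (bip ?m) - (D0 \<union> D1 \<union> D2)) F"
    then have "2 * l dvd card ({False} \<times> {..<?m})"
    proof (rule cycle_factor_cut)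
      show "{False} \<times> {..<?m} \<subseteq> bip ?m" by (auto simp: bip_def)
    qed (use bridge in metis)
    moreover have "card ({False} \<times> {..<?m}) = ?m"
      by (simp add: card_cartesian_product)
    ultimately have "even ?m"
      by (metis dvd_mult_left)
    then show False
      using l(1) P(1) by simp
  qed
  from nonextendable_tournament[OF finite_bip card_bip D this] show ?thesis
    by simp
qed

text \<open>Every round must also cover the players outside \<open>A\<close>. They form
  \<open>2 * h + 1\<close> parts of odd size \<open>g\<close>, for which \<open>h * g\<close> rounds
  exist; as \<open>N \<le> g\<close>, enough of them can be paired with the \<open>h * N\<close>
  rounds inside \<open>A\<close>.\<close>

lemma nonextendable_odd:
  assumes "h \<ge> 1" and N: "(2 * h + 1) ^ Suc i = 1 + 2 * h * N" "(2 * h + 1) ^ i \<le> N"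
  shows "\<exists>Hs. tournament (2 * h + 1) (2 * (2 * h + 1) * N) Hs \<and>
    \<not> can_be_extended (2 * h + 1) (2 * (2 * h + 1) * N) Hs \<and> length Hs = h * N"
proof -
  define k where "k = 2 * h + 1"
  define M where "M = k ^ Suc i"
  \<comment> \<open>Chosen so that \<open>M + k * g = 2 * k * N\<close>; it is odd because
    \<open>k ^ i\<close> is.\<close>
  define g where "g = 2 * N - k ^ i"
  have M: "M = 1 + 2 * (h * N)" using N(1) by (simp add: M_def k_def)
  have ki: "k ^ i \<le> N" "odd (k ^ i)" using N(2) by (simp_all add: k_def)
  have g: "odd g" "N \<le> g" using ki by (auto simp: g_def)
  have n: "M + k * g = 2 * k * N"
  proof -
    have "k * g + k * k ^ i = k * (2 * N)"
      using ki by (simp add: g_def flip: distrib_left)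
    then show ?thesis by (simp add: M_def)
  qed
  obtain DA where DA: "decomposes k {..<M} DA ((M - 1) div 2)"
    using decomposes_complete_power[OF assms(1)] unfolding M_def k_def by blast
  have r: "(M - 1) div 2 = h * N" using M by simp
  have "card (complete_edges {..<M}) = M choose 2"
    using n_subsets[of "{..<M}" 2] by (simp add: complete_edges_def)
  also have "\<dots> = h * N * M"
    using M by (simp add: choose_two)
  finally have "DA = complete_edges {..<M}"
    using decomposes_eq[OF DA decomposes_edges[OF DA]] r by (simp add: complete_edges_def)
  obtain D1 where D1: "decomposes k {..<k * g} D1 (h * g)"
    using decomposes_multipartite[OF assms(1) g(1)] unfolding k_def by blast
  have "h * N \<le> h * g" using g(2) by simp
  then obtain D2 where D2: "decomposes k {..<k * g} D2 (h * N)"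
    using decomposes_fewer[OF D1] by blast
  define DB where "DB = (`) ((+) M) ` D2"
  have "(+) M ` {..<k * g} = {M..<2 * k * N}"
    unfolding n[symmetric] lessThan_atLeast0 by (simp add: add.commute)
  then have DB: "decomposes k {M..<2 * k * N} DB (h * N)"
    using decomposes_image[OF D2, of "(+) M"] by (simp add: DB_def)
  have "{..<M} \<union> {M..<2 * k * N} = {..<2 * k * N}"
    unfolding n[symmetric] by auto
  moreover have "decomposes k ({..<M} \<union> {M..<2 * k * N}) (DA \<union> DB) (h * N)"
    using DA DB r by (intro decomposes_Un) auto
  ultimately have D: "decomposes k {..<2 * k * N} (DA \<union> DB) (h * N)"
    by simp
  have "\<not> cycle_factor k {..<2 * k * N} (complete_edges {..<2 * k * N} - (DA \<union> DB)) F" for F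
  proof
    assume F: "cycle_factor k {..<2 * k * N} (complete_edges {..<2 * k * N} - (DA \<union> DB)) F"
    have "card {..<M} \<le> h * card F"
    proof (rule cycle_factor_independent[OF F[unfolded k_def]])
      show "{..<M} \<subseteq> {..<2 * (2 * h + 1) * N}"
        using n by (auto simp: k_def)
    qed (auto simp: \<open>DA = _\<close> complete_edges_def)
    moreover have "k * card F = k * (2 * N)" "k > 0"
      using cycle_factorD(2)[OF F] by (simp_all add: k_def)
    then have "card F = 2 * N"
      by (metis nat_mult_eq_cancel1)
    ultimately show False using M by simp
  qed
  from nonextendable_tournament[OF _ _ D this] show ?thesis
    unfolding k_def by simp
qed

theorem theorem4:
  fixes k :: nat
  assumes "k \<ge> 3"
  shows
    "(odd k \<longrightarrow>
        infinite {n. n > 0 \<and> k dvd n \<and>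
          (\<exists>Hs. tournament k n Hs \<and> \<not> can_be_extended k n Hs \<and>
             int (length Hs) = \<lfloor>(real n + 2) / 4 - real n / (4 * real k)\<rfloor>)}) \<and>
     (k mod 4 = 0 \<longrightarrow>
        infinite {n. n > 0 \<and> k dvd n \<and>
          (\<exists>Hs. tournament k n Hs \<and> \<not> can_be_extended k n Hs \<and>
             int (length Hs) = \<lfloor>(real n + 2) / 4\<rfloor>)}) \<and>
     (k mod 4 = 2 \<longrightarrow>
        infinite {n. n > 0 \<and> k dvd n \<and>
          (\<exists>Hs. tournament k n Hs \<and> \<not> can_be_extended k n Hs \<and>
             int (length Hs) = \<lfloor>(real n + 2) / 4\<rfloor> + 1)})"
proof (intro conjI impI)
  assume "odd k"
  then obtain h where h: "k = 2 * h + 1" by (rule oddE)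
  have "h \<ge> 1" using assms h by simp
  show "infinite {n. n > 0 \<and> k dvd n \<and>
          (\<exists>Hs. tournament k n Hs \<and> \<not> can_be_extended k n Hs \<and>
             int (length Hs) = \<lfloor>(real n + 2) / 4 - real n / (4 * real k)\<rfloor>)}"
    unfolding infinite_nat_iff_unbounded mem_Collect_eq
  proof (intro allI)
    fix b :: nat
    \<comment> \<open>\<open>N\<close> is the geometric sum \<open>1 + k + ... + k ^ i\<close>,
      whence the recursion \<open>k * N + 1\<close>.\<close>
    have "\<exists>N. k ^ Suc i = 1 + 2 * h * N \<and> k ^ i \<le> N" for i
    proof (induction i)
      case 0
      show ?case by (intro exI[of _ 1]) (simp add: h)
    next
      case (Suc i)
      then obtain N where N: "k ^ Suc i = 1 + 2 * h * N" "k ^ i \<le> N" by blast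
      have "k ^ Suc (Suc i) = 1 + 2 * h * (k * N + 1)"
        unfolding power_Suc[of k "Suc i"] N(1) by (simp add: h algebra_simps)
      moreover have "k ^ Suc i \<le> k * N + 1"
        using mult_le_mono2[OF N(2), of k] unfolding power_Suc by linarith
      ultimately show ?case by blast
    qed
    then obtain N where N: "k ^ Suc b = 1 + 2 * h * N" "k ^ b \<le> N" by blast
    have "b < k ^ b" using assms by (intro power_gt_expt) simp
    let ?n = "2 * k * N"
    obtain Hs where Hs: "tournament k ?n Hs" "\<not> can_be_extended k ?n Hs" "length Hs = h * N"
      using nonextendable_odd[OF \<open>h \<ge> 1\<close> N[unfolded h]] unfolding h by blast
    have "real ?n / (4 * real k) = real N / 2"
      using assms by (simp add: field_simps)
    then have "(real ?n + 2) / 4 - real ?n / (4 * real k) = real (h * N) + 1 / 2"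
      unfolding h by (simp add: field_simps)
    moreover have "\<lfloor>real (h * N) + 1 / 2\<rfloor> = int (h * N)"
      by (intro floor_unique) auto
    ultimately have "int (length Hs) = \<lfloor>(real ?n + 2) / 4 - real ?n / (4 * real k)\<rfloor>"
      using Hs(3) by simp
    moreover have "b < ?n"
    proof -
      have "1 * N \<le> 2 * k * N" using assms by (intro mult_right_mono) auto
      then show ?thesis using N(2) \<open>b < k ^ b\<close> by linarith
    qed
    moreover from this have "?n > 0" by linarith
    moreover have "k dvd ?n" by simp
    ultimately show "\<exists>n>b. n > 0 \<and> k dvd n \<and>
          (\<exists>Hs. tournament k n Hs \<and> \<not> can_be_extended k n Hs \<and>
             int (length Hs) = \<lfloor>(real n + 2) / 4 - real n / (4 * real k)\<rfloor>)"
      using Hs by blast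
  qed
next
  assume "k mod 4 = 0"
  then obtain a where a: "k = 4 * a" by (auto elim: dvdE)
  then have "a \<ge> 1" using assms by simp
  show "infinite {n. n > 0 \<and> k dvd n \<and>
          (\<exists>Hs. tournament k n Hs \<and> \<not> can_be_extended k n Hs \<and>
             int (length Hs) = \<lfloor>(real n + 2) / 4\<rfloor>)}"
    unfolding infinite_nat_iff_unbounded mem_Collect_eq
  proof (intro allI)
    fix b :: nat
    \<comment> \<open>Any odd factor works; this one makes \<open>n\<close> exceed
      \<open>b\<close>.\<close>
    let ?p = "2 * b + 1"
    let ?n = "k * ?p"
    have n: "?n = 2 * (2 * a * ?p)" "?n = 4 * (a * ?p)" using a by simp_all
    obtain Hs where Hs: "tournament k ?n Hs" "\<not> can_be_extended k ?n Hs" "length Hs = a * ?p"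
      using nonextendable_doubly_even[of "2 * a" ?p] \<open>a \<ge> 1\<close> a unfolding n(1) by auto
    have "(real ?n + 2) / 4 = real (a * ?p) + 1 / 2"
      unfolding n(2) by simp
    moreover have "\<lfloor>real (a * ?p) + 1 / 2\<rfloor> = int (a * ?p)"
      by (intro floor_unique) auto
    ultimately have "int (length Hs) = \<lfloor>(real ?n + 2) / 4\<rfloor>"
      unfolding Hs(3) by (simp only:)
    moreover have "1 * ?p \<le> k * ?p" using assms by (intro mult_right_mono) auto
    then have "b < ?n" by simp
    moreover from this have "?n > 0" by linarith
    moreover have "k dvd ?n" by simp
    ultimately show "\<exists>n>b. n > 0 \<and> k dvd n \<and>
          (\<exists>Hs. tournament k n Hs \<and> \<not> can_be_extended k n Hs \<and>
             int (length Hs) = \<lfloor>(real n + 2) / 4\<rfloor>)"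
      using Hs by blast
  qed
next
  assume k4: "k mod 4 = 2"
  define l where "l = k div 2"
  have l: "k = 2 * l" "odd l" using k4 unfolding l_def by presburger+
  have "l \<ge> 3" using assms l by (cases "l = 2") auto
  show "infinite {n. n > 0 \<and> k dvd n \<and>
          (\<exists>Hs. tournament k n Hs \<and> \<not> can_be_extended k n Hs \<and>
             int (length Hs) = \<lfloor>(real n + 2) / 4\<rfloor> + 1)}"
    unfolding infinite_nat_iff_unbounded mem_Collect_eq
  proof (intro allI)
    fix b :: nat
    define q where "q = l - 1"
    have q: "l = q + 1" "even q" using l(2) \<open>l \<ge> 3\<close> by (auto simp: q_def)
    \<comment> \<open>Here \<open>c = 1 + l + ... + l ^ (2 * s)\<close>; the odd exponent gives an
      odd number of odd terms, so \<open>c\<close> is odd.\<close>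
    have "\<exists>c. l ^ (2 * s + 1) = c * q + 1 \<and> odd c" for s
    proof (induction s)
      case 0
      show ?case by (intro exI[of _ 1]) (simp add: q)
    next
      case (Suc s)
      then obtain c where c: "l ^ (2 * s + 1) = c * q + 1" "odd c" by blast
      have "l ^ (2 * Suc s + 1) = l * (l * l ^ (2 * s + 1))" by simp
      also have "\<dots> = (l + 1 + l * l * c) * q + 1"
        unfolding c(1) by (simp add: q algebra_simps)
      finally show ?case using c(2) l(2) by (intro exI[of _ "l + 1 + l * l * c"]) simp
    qed
    then obtain c where c: "l ^ (2 * (b + 1) + 1) = c * q + 1" "odd c" by blast
    \<comment> \<open>The exponent is at least 3, since \<open>P = l\<close> would violate
      \<open>2 * l \<le> P\<close>.\<close>
    define P where "P = l ^ (2 * (b + 1) + 1)"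
    have P: "P = l * (l * l ^ (2 * b + 1))" by (simp add: P_def)
    have "2 * b + 1 < l ^ (2 * b + 1)" using \<open>l \<ge> 3\<close> by (intro power_gt_expt) simp
    moreover have big: "2 * l * l ^ (2 * b + 1) \<le> P"
      unfolding P using \<open>l \<ge> 3\<close> by (simp add: mult_right_mono)
    ultimately have "2 * l * 1 \<le> P" "b < P"
      using mult_le_mono2[of 1 "l ^ (2 * b + 1)" "2 * l"] mult_right_mono[of 1 "2 * l" "l ^ (2 * b + 1)"] \<open>l \<ge> 3\<close>
      by linarith+
    let ?n = "2 * (l * P)"
    obtain Hs where Hs: "tournament k ?n Hs" "\<not> can_be_extended k ?n Hs" "length Hs = (l * P - 1) div 2 + 2"
      using nonextendable_singly_even[OF l(2) \<open>l \<ge> 3\<close> P_def, of c] c \<open>2 * l * 1 \<le> P\<close>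
      unfolding l(1) P_def q_def by auto
    \<comment> \<open>With \<open>l * P = 2 * w + 1\<close> the floor is exactly
      \<open>w + 1\<close>, while the tournament has \<open>w + 2\<close> rounds.\<close>
    have "odd (l * P)" using l(2) by (simp add: P_def)
    then obtain w where w: "l * P = 2 * w + 1" by (rule oddE)
    have "(real ?n + 2) / 4 = real (w + 1)"
      unfolding w by simp
    then have floor: "\<lfloor>(real ?n + 2) / 4\<rfloor> = int (w + 1)"
      by (simp only: floor_of_nat)
    have "int (length Hs) = \<lfloor>(real ?n + 2) / 4\<rfloor> + 1"
      unfolding floor unfolding Hs(3) w by simp
    moreover have "1 * P \<le> l * P" using \<open>l \<ge> 3\<close> by (intro mult_right_mono) auto
    then have "b < ?n" using \<open>b < P\<close> by linarith
    moreover from this have "?n > 0" by linarith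
    moreover have "k dvd ?n" by (simp add: l(1))
    ultimately show "\<exists>n>b. n > 0 \<and> k dvd n \<and>
          (\<exists>Hs. tournament k n Hs \<and> \<not> can_be_extended k n Hs \<and>
             int (length Hs) = \<lfloor>(real n + 2) / 4\<rfloor> + 1)"
      using Hs by blast
  qed
qed

end
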